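(* Let $\mathcal H$ be a separable Hilbert space. Then $\mathbf E(\mathcal H)=(\mathcal E(\mathcal H),\land_s,\lor_s,{}',\mathbb O,\mathbb I)$ is a boundedly complete super-paraorthomodular lattice.
   Context: $\mathcal E(\mathcal H)$ is the set of effects on $\mathcal H$, i.e. bounded self-adjoint linear operators $A$ with $0\leq \mathrm{Tr}(\rho A)\leq 1$ for every density operator $\rho$; $\mathbb O,\mathbb I$ are the null and identity operators. Every bounded self-adjoint operator $A$ has a unique (bounded, right-continuous, monotone) spectral family $\lambda\mapsto A_\lambda$ of projections with $A=\int x\,dA_x$. The spectral order is $E\leq_s F$ iff $F_\lambda\leq E_\lambda$ for all $\lambda\in\mathbb R$; it is a lattice order with operations given by $(A\lor_s B)_\lambda=A_\lambda\land B_\lambda$ and $(A\land_s B)_\lambda=\bigwedge_{\mu>\lambda}(A_\mu\lor B_\mu)$ (lattice operations of projections), and $A'=\mathbb I-A$. Boundedly complete: every bounded subset has a supremum and an infimum. A pseudo-Kleene lattice is an algebra $(A,\land,\lor,{}',0,1)$ that is a bounded lattice with an antitone involution ${}'$ ($x\leq y\Rightarrow y'\leq x'$, $x''=x$) satisfying $x\land x'\leq y\lor y'$. It is super-paraorthomodular if for all $x,y$: (SP1) $x\leq y$ and $x'\land y=(x\land x')\lor(y\land y')$ imply $y\land(x\lor x')=x\lor(y\land y')$; (SP2) $x\leq y$ implies $(x\land x')\lor(y\land y')=(x'\land y)\land(x'\land y)'$. *)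

theory Defs
  imports "HOL-Analysis.Analysis"
begin

text \<open>A complex Hilbert space H is represented by its underlying real Hilbert space
 (a type of class real_inner + complete_space) together with the operator J of
 multiplication by the imaginary unit. The complex inner product is
 <x,y>_C = inner x y + i * inner x (J y).\<close>

definition complex_structure :: "('a::real_inner \<Rightarrow> 'a) \<Rightarrow> bool" where
  "complex_structure J \<longleftrightarrow> linear J \<and> (\<forall>x. J (J x) = - x) \<and> (\<forall>x y. inner (J x) (J y) = inner x y)"

definition is_bop :: "('a::real_inner \<Rightarrow> 'a) \<Rightarrow> ('a \<Rightarrow> 'a) \<Rightarrow> bool" where
  "is_bop J A \<longleftrightarrow> bounded_linear A \<and> (\<forall>x. A (J x) = J (A x))"

text \<open>Bounded self-adjoint operators (w.r.t. the complex inner product).\<close>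
definition is_bsa :: "('a::real_inner \<Rightarrow> 'a) \<Rightarrow> ('a \<Rightarrow> 'a) \<Rightarrow> bool" where
  "is_bsa J A \<longleftrightarrow> is_bop J A \<and> (\<forall>x y. inner (A x) y = inner x (A y))"

text \<open>Effects: bounded self-adjoint A with 0 \<le> A \<le> I, i.e. 0 \<le> <x,Ax> \<le> <x,x>
 (equivalently 0 \<le> Tr(rho A) \<le> 1 for all density operators rho).\<close>
definition effects :: "('a::real_inner \<Rightarrow> 'a) \<Rightarrow> ('a \<Rightarrow> 'a) set" where
  "effects J = {A. is_bsa J A \<and> (\<forall>x. 0 \<le> inner x (A x) \<and> inner x (A x) \<le> inner x x)}"

definition is_proj :: "('a::real_inner \<Rightarrow> 'a) \<Rightarrow> ('a \<Rightarrow> 'a) \<Rightarrow> bool" where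
  "is_proj J P \<longleftrightarrow> is_bsa J P \<and> P \<circ> P = P"

definition proj_le :: "('a \<Rightarrow> 'a) \<Rightarrow> ('a \<Rightarrow> 'a) \<Rightarrow> bool" where
  "proj_le P Q \<longleftrightarrow> Q \<circ> P = P"

definition proj_Inf :: "('a::real_inner \<Rightarrow> 'a) \<Rightarrow> ('a \<Rightarrow> 'a) set \<Rightarrow> ('a \<Rightarrow> 'a)" where
  "proj_Inf J S = (THE P. is_proj J P \<and> (\<forall>Q\<in>S. proj_le P Q) \<and>
      (\<forall>R. is_proj J R \<and> (\<forall>Q\<in>S. proj_le R Q) \<longrightarrow> proj_le R P))"

definition proj_Sup :: "('a::real_inner \<Rightarrow> 'a) \<Rightarrow> ('a \<Rightarrow> 'a) set \<Rightarrow> ('a \<Rightarrow> 'a)" where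
  "proj_Sup J S = (THE P. is_proj J P \<and> (\<forall>Q\<in>S. proj_le Q P) \<and>
      (\<forall>R. is_proj J R \<and> (\<forall>Q\<in>S. proj_le Q R) \<longrightarrow> proj_le P R))"

definition proj_inf :: "('a::real_inner \<Rightarrow> 'a) \<Rightarrow> ('a \<Rightarrow> 'a) \<Rightarrow> ('a \<Rightarrow> 'a) \<Rightarrow> ('a \<Rightarrow> 'a)" where
  "proj_inf J P Q = proj_Inf J {P, Q}"

definition proj_sup :: "('a::real_inner \<Rightarrow> 'a) \<Rightarrow> ('a \<Rightarrow> 'a) \<Rightarrow> ('a \<Rightarrow> 'a) \<Rightarrow> ('a \<Rightarrow> 'a)" where
  "proj_sup J P Q = proj_Sup J {P, Q}"

text \<open>E is the spectral family of A: a bounded, monotone, strongly right-continuous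
 family of projections with A = integral of x dE_x (in the weak sense: for every
 vector x, <x,Ax> is the Lebesgue-Stieltjes integral of t w.r.t. t \<mapsto> <x,E_t x>).\<close>
definition spectral_family :: "('a::real_inner \<Rightarrow> 'a) \<Rightarrow> ('a \<Rightarrow> 'a) \<Rightarrow> (real \<Rightarrow> 'a \<Rightarrow> 'a) \<Rightarrow> bool" where
  "spectral_family J A E \<longleftrightarrow>
     (\<forall>t. is_proj J (E t)) \<and>
     (\<forall>s t. s \<le> t \<longrightarrow> proj_le (E s) (E t)) \<and>
     (\<forall>t x. ((\<lambda>s. E s x) \<longlongrightarrow> E t x) (at_right t)) \<and>
     (\<exists>a b. (\<forall>t. t < a \<longrightarrow> E t = (\<lambda>x. 0)) \<and> (\<forall>t. b \<le> t \<longrightarrow> E t = id)) \<and>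
     (\<forall>x. integrable (interval_measure (\<lambda>t. inner x (E t x))) (\<lambda>t. t) \<and>
          inner x (A x) = integral\<^sup>L (interval_measure (\<lambda>t. inner x (E t x))) (\<lambda>t. t))"

definition spec :: "('a::real_inner \<Rightarrow> 'a) \<Rightarrow> ('a \<Rightarrow> 'a) \<Rightarrow> real \<Rightarrow> 'a \<Rightarrow> 'a" where
  "spec J A = (THE E. spectral_family J A E)"

definition spec_le :: "('a::real_inner \<Rightarrow> 'a) \<Rightarrow> ('a \<Rightarrow> 'a) \<Rightarrow> ('a \<Rightarrow> 'a) \<Rightarrow> bool" where
  "spec_le J A B \<longleftrightarrow> (\<forall>t. proj_le (spec J B t) (spec J A t))"

definition join_s :: "('a::real_inner \<Rightarrow> 'a) \<Rightarrow> ('a \<Rightarrow> 'a) \<Rightarrow> ('a \<Rightarrow> 'a) \<Rightarrow> ('a \<Rightarrow> 'a)" where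
  "join_s J A B = (THE C. is_bsa J C \<and> spec J C = (\<lambda>t. proj_inf J (spec J A t) (spec J B t)))"

definition meet_s :: "('a::real_inner \<Rightarrow> 'a) \<Rightarrow> ('a \<Rightarrow> 'a) \<Rightarrow> ('a \<Rightarrow> 'a) \<Rightarrow> ('a \<Rightarrow> 'a)" where
  "meet_s J A B = (THE C. is_bsa J C \<and>
      spec J C = (\<lambda>t. proj_Inf J {proj_sup J (spec J A m) (spec J B m) | m. m > t}))"

definition op_compl :: "('a::real_vector \<Rightarrow> 'a) \<Rightarrow> ('a \<Rightarrow> 'a)" where
  "op_compl A = (\<lambda>x. x - A x)"

definition lat_le :: "('b \<Rightarrow> 'b \<Rightarrow> 'b) \<Rightarrow> 'b \<Rightarrow> 'b \<Rightarrow> bool" where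
  "lat_le m x y \<longleftrightarrow> m x y = x"

definition bounded_lattice_alg ::
  "'b set \<Rightarrow> ('b \<Rightarrow> 'b \<Rightarrow> 'b) \<Rightarrow> ('b \<Rightarrow> 'b \<Rightarrow> 'b) \<Rightarrow> 'b \<Rightarrow> 'b \<Rightarrow> bool" where
  "bounded_lattice_alg C m j z u \<longleftrightarrow>
     z \<in> C \<and> u \<in> C \<and>
     (\<forall>x\<in>C. \<forall>y\<in>C. m x y \<in> C \<and> j x y \<in> C) \<and>
     (\<forall>x\<in>C. \<forall>y\<in>C. m x y = m y x \<and> j x y = j y x) \<and>
     (\<forall>x\<in>C. \<forall>y\<in>C. \<forall>w\<in>C. m x (m y w) = m (m x y) w \<and> j x (j y w) = j (j x y) w) \<and>
     (\<forall>x\<in>C. \<forall>y\<in>C. m x (j x y) = x \<and> j x (m x y) = x) \<and>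
     (\<forall>x\<in>C. m z x = z \<and> j u x = u)"

definition pseudo_kleene_lattice ::
  "'b set \<Rightarrow> ('b \<Rightarrow> 'b \<Rightarrow> 'b) \<Rightarrow> ('b \<Rightarrow> 'b \<Rightarrow> 'b) \<Rightarrow> ('b \<Rightarrow> 'b) \<Rightarrow> 'b \<Rightarrow> 'b \<Rightarrow> bool" where
  "pseudo_kleene_lattice C m j c z u \<longleftrightarrow>
     bounded_lattice_alg C m j z u \<and>
     (\<forall>x\<in>C. c x \<in> C \<and> c (c x) = x) \<and>
     (\<forall>x\<in>C. \<forall>y\<in>C. lat_le m x y \<longrightarrow> lat_le m (c y) (c x)) \<and>
     (\<forall>x\<in>C. \<forall>y\<in>C. lat_le m (m x (c x)) (j y (c y)))"

definition super_paraorthomodular ::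
  "'b set \<Rightarrow> ('b \<Rightarrow> 'b \<Rightarrow> 'b) \<Rightarrow> ('b \<Rightarrow> 'b \<Rightarrow> 'b) \<Rightarrow> ('b \<Rightarrow> 'b) \<Rightarrow> 'b \<Rightarrow> 'b \<Rightarrow> bool" where
  "super_paraorthomodular C m j c z u \<longleftrightarrow>
     pseudo_kleene_lattice C m j c z u \<and>
     (\<forall>x\<in>C. \<forall>y\<in>C. lat_le m x y \<and> m (c x) y = j (m x (c x)) (m y (c y)) \<longrightarrow>
         m y (j x (c x)) = j x (m y (c y))) \<and>
     (\<forall>x\<in>C. \<forall>y\<in>C. lat_le m x y \<longrightarrow>
         j (m x (c x)) (m y (c y)) = m (m (c x) y) (c (m (c x) y)))"

definition boundedly_complete :: "'b set \<Rightarrow> ('b \<Rightarrow> 'b \<Rightarrow> 'b) \<Rightarrow> bool" where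
  "boundedly_complete C m \<longleftrightarrow>
     (\<forall>S\<subseteq>C. (\<exists>b\<in>C. \<forall>x\<in>S. lat_le m x b) \<longrightarrow>
        (\<exists>s\<in>C. (\<forall>x\<in>S. lat_le m x s) \<and> (\<forall>b\<in>C. (\<forall>x\<in>S. lat_le m x b) \<longrightarrow> lat_le m s b))) \<and>
     (\<forall>S\<subseteq>C. (\<exists>b\<in>C. \<forall>x\<in>S. lat_le m b x) \<longrightarrow>
        (\<exists>s\<in>C. (\<forall>x\<in>S. lat_le m s x) \<and> (\<forall>b\<in>C. (\<forall>x\<in>S. lat_le m b x) \<longrightarrow> lat_le m b s)))"

end

theory Submission
  imports Defs
begin

text \<open>An effect \<open>A\<close> is encoded by its spectral subspaces \<open>L A t = ran A\<^sub>t\<close>, a right-continuous increasing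
  family of closed subspaces with \<open>L A t = 0\<close> for \<open>t < 0\<close> and \<open>L A t = H\<close> for \<open>t \<ge> 1\<close>; every such family
  comes from exactly one effect. It is determined by \<open>A \<le> t\<close> on \<open>L A t\<close> and \<open>A \<ge> t\<close> on its orthogonal
  complement, because the norms of the powers of \<open>A + c\<close> separate the two; existence follows from the
  splitting of \<open>A - t\<close> into its positive and negative parts by means of \<open>\<bar>A - t\<bar>\<close>.

  The complement satisfies \<open>L A' t \<subseteq> (L A s)\<^sup>\<bottom>\<close> for \<open>s + t < 1\<close>. Hence for \<open>A \<le> B\<close> and \<open>t < 1/2\<close> the meets
  \<open>A \<and> A'\<close>, \<open>B \<and> B'\<close> and \<open>A' \<and> B\<close> have spectral subspaces that are plain orthogonal sums, and
  (SP2) becomes an identity of subspaces below the level 1/2; above that level both sides are the whole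
  space. (SP1) below 1/2 is similar, and above 1/2 it follows by applying it to \<open>B' \<le> A'\<close>.\<close>

section \<open>Orthogonal projections\<close>

text \<open>The obstacle is the meet of effects: a closed hull of a sum under an intersection over
  all higher levels. The level 1/2 is the fixed point of the reflection t -> 1 - t that the
  complement performs on the spectrum: for t < 1/2 one has t < 1 - t, so the subspaces of A and A'
  at level t are orthogonal. Correspondingly I/2 is its own complement and lies between A \<and> A'
  and B \<or> B', which is the Kleene inequality. Since \<open>spec\<close> and the operations are
  definite descriptions, existence and uniqueness of spectral families must come before any
  statement about them. Spectral arguments run on the two-sided bounds; the Stieltjes integral
  identifies these bounds with the definition and shows that the family determines the operator.
  Complex scalars enter only as invariance of subspaces under \<open>J\<close>.\<close>

lemma orth_iff: "x \<in> M\<^sup>\<bottom> \<longleftrightarrow> (\<forall>y\<in>M. inner y x = 0)"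
  by (simp add: orthogonal_comp_def orthogonal_def)

lemma orthD: "x \<in> M\<^sup>\<bottom> \<Longrightarrow> y \<in> M \<Longrightarrow> inner y x = 0" "x \<in> M\<^sup>\<bottom> \<Longrightarrow> y \<in> M \<Longrightarrow> inner x y = 0"
  by (auto simp: orth_iff inner_commute)

lemma orth_self: "x \<in> M \<Longrightarrow> x \<in> M\<^sup>\<bottom> \<Longrightarrow> x = 0"
  using orthD(1)[of x M x] by simp

lemma closed_orth: "closed (M\<^sup>\<bottom>)"
proof -
  have "M\<^sup>\<bottom> = (\<Inter>y\<in>M. {x. inner y x = 0})" by (auto simp: orth_iff)
  moreover have "closed {x. inner y x = 0}" for y :: 'a
    by (intro closed_Collect_eq continuous_intros)
  ultimately show ?thesis by auto
qed

lemma csubspace_orth: "closed (M\<^sup>\<bottom>) \<and> subspace (M\<^sup>\<bottom>)"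
  by (simp add: closed_orth subspace_orthogonal_comp)

lemma orth_antimono: "M \<subseteq> N \<Longrightarrow> N\<^sup>\<bottom> \<subseteq> M\<^sup>\<bottom>"
  by (force simp: orth_iff)

lemma subset_orth_sym: "M \<subseteq> N\<^sup>\<bottom> \<longleftrightarrow> N \<subseteq> M\<^sup>\<bottom>"
  by (metis orthD(2) orth_iff subset_iff)

lemma norm_add_orth: "inner x y = 0 \<Longrightarrow> (norm (x + y))\<^sup>2 = (norm x)\<^sup>2 + (norm (y::'a::real_inner))\<^sup>2"
  by (simp add: power2_norm_eq_inner inner_add inner_commute)

lemma parallelogram:
  fixes x y :: "'a::real_inner"
  shows "(norm (x - y))\<^sup>2 = 2 * (norm x)\<^sup>2 + 2 * (norm y)\<^sup>2 - 4 * (norm ((1/2) *\<^sub>R (x + y)))\<^sup>2"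
  by (simp add: power2_norm_eq_inner inner_diff inner_add algebra_simps inner_commute)

text \<open>A minimizing sequence for the distance to \<open>M\<close> is Cauchy by the
  parallelogram identity, since midpoints stay in \<open>M\<close>; minimality of the limit then
  makes the error orthogonal to \<open>M\<close>.\<close>

lemma projection_exists:
  fixes M :: "'a::{real_inner, complete_space} set"
  assumes cl: "closed M" and sub: "subspace M"
  shows "\<exists>y\<in>M. x - y \<in> M\<^sup>\<bottom>"
proof -
  define d where "d = infdist x M"
  have ne: "M \<noteq> {}" using subspace_0[OF sub] by auto
  have dle: "d \<le> norm (x - z)" if "z \<in> M" for z
    using infdist_le[OF that, of x] by (simp add: d_def dist_norm)
  have d0: "0 \<le> d" by (simp add: d_def infdist_nonneg)
  have "\<exists>y\<in>M. (norm (x - y))\<^sup>2 < d\<^sup>2 + inverse (Suc n)" for n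
  proof -
    have lt: "d < sqrt (d\<^sup>2 + inverse (Suc n))"
      by (rule real_less_rsqrt) simp
    have "\<exists>y\<in>M. dist x y < sqrt (d\<^sup>2 + inverse (Suc n))"
      using lt ne unfolding d_def infdist_notempty[OF ne]
      by (subst (asm) cINF_less_iff) auto
    then obtain y where "y \<in> M" "norm (x - y) < sqrt (d\<^sup>2 + inverse (Suc n))"
      by (auto simp: dist_norm)
    moreover have "0 \<le> d\<^sup>2 + inverse (real (Suc n))" by simp
    ultimately show ?thesis
      by (metis norm_ge_zero real_sqrt_less_iff real_sqrt_abs abs_of_nonneg)
  qed
  then obtain Y where YM: "\<And>n. Y n \<in> M" and Yd: "\<And>n. (norm (x - Y n))\<^sup>2 < d\<^sup>2 + inverse (Suc n)"
    by metis
  \<comment> \<open>Both points have squared distance below d^2 + 1/(N+1) from \<open>x\<close>, and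
    their midpoint is no closer than d, so the parallelogram identity leaves 4/(N+1).\<close>
  have dist2: "(norm (Y m - Y n))\<^sup>2 \<le> 4 * inverse (Suc N)" if "m \<ge> N" "n \<ge> N" for m n N
  proof -
    have mid: "(1/2) *\<^sub>R (Y m + Y n) \<in> M"
      by (intro subspace_scale subspace_add sub YM)
    have "d\<^sup>2 \<le> (norm (x - (1/2) *\<^sub>R (Y m + Y n)))\<^sup>2"
      using dle[OF mid] d0 by (intro power_mono) auto
    moreover have "x - (1/2) *\<^sub>R (Y m + Y n) = (1/2) *\<^sub>R ((x - Y m) + (x - Y n))"
      by (simp add: algebra_simps flip: scaleR_2)
    moreover have "inverse (real (Suc m)) \<le> inverse (Suc N)" "inverse (real (Suc n)) \<le> inverse (Suc N)"
      using that by (auto simp: field_simps)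
    moreover have "(norm (Y m - Y n))\<^sup>2 = 2 * (norm (x - Y m))\<^sup>2 + 2 * (norm (x - Y n))\<^sup>2
        - 4 * (norm ((1/2) *\<^sub>R ((x - Y m) + (x - Y n))))\<^sup>2"
      using parallelogram[of "x - Y m" "x - Y n"] by (simp add: norm_minus_commute)
    ultimately show ?thesis
      using Yd[of m] Yd[of n] by (smt (verit))
  qed
  have "Cauchy Y"
  proof (rule CauchyI)
    fix e :: real assume "e > 0"
    then have "e\<^sup>2 / 4 > 0" by simp
    from reals_Archimedean[OF this] obtain N where N: "inverse (Suc N) < e\<^sup>2 / 4" by auto
    have "norm (Y m - Y n) < e" if "m \<ge> N" "n \<ge> N" for m n
    proof -
      have "(norm (Y m - Y n))\<^sup>2 < e\<^sup>2" using dist2[OF that] N by simp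
      then show ?thesis using \<open>e > 0\<close> by (simp add: power2_less_imp_less)
    qed
    then show "\<exists>N. \<forall>m\<ge>N. \<forall>n\<ge>N. norm (Y m - Y n) < e" by blast
  qed
  then obtain y where y: "Y \<longlonglongrightarrow> y" using Cauchy_convergent convergent_def by blast
  have yM: "y \<in> M" using closed_sequentially[OF cl] YM y by blast
  have "(\<lambda>n. (norm (x - Y n))\<^sup>2) \<longlonglongrightarrow> (norm (x - y))\<^sup>2" by (intro tendsto_intros y)
  moreover have "(\<lambda>n. d\<^sup>2 + inverse (Suc n)) \<longlonglongrightarrow> d\<^sup>2 + 0"
    by (intro tendsto_add tendsto_const LIMSEQ_inverse_real_of_nat)
  ultimately have "(norm (x - y))\<^sup>2 \<le> d\<^sup>2 + 0"
    using Yd by (intro LIMSEQ_le) (auto intro: less_imp_le)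
  then have yd: "(norm (x - y))\<^sup>2 \<le> d\<^sup>2" by simp
  have "inner z (x - y) = 0" if "z \<in> M" for z
  proof (cases "z = 0")
    case False
    \<comment> \<open>The value minimizing the distance from \<open>x\<close> to y + c z; it would
      lower the squared distance by (inner z (x - y))^2 / inner z z.\<close>
    define c where "c = inner z (x - y) / inner z z"
    have "y + c *\<^sub>R z \<in> M" by (intro subspace_add subspace_scale sub yM that)
    then have "d\<^sup>2 \<le> (norm (x - (y + c *\<^sub>R z)))\<^sup>2" using dle d0 by (intro power_mono) auto
    also have "\<dots> = (norm (x - y))\<^sup>2 - 2 * c * inner z (x - y) + c\<^sup>2 * inner z z"
      unfolding power2_norm_eq_inner
      by (simp add: inner_diff inner_add inner_commute power2_eq_square) (simp add: algebra_simps)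
    also have "\<dots> = (norm (x - y))\<^sup>2 - (inner z (x - y))\<^sup>2 / inner z z"
      using False by (simp add: c_def power2_eq_square field_simps)
    finally have "(inner z (x - y))\<^sup>2 / inner z z \<le> 0" using yd by linarith
    then show ?thesis using False
      by (smt (verit) divide_pos_pos inner_gt_zero_iff zero_less_power2)
  qed simp
  then show ?thesis using yM by (auto simp: orth_iff)
qed

definition prj :: "'a::real_inner set \<Rightarrow> 'a \<Rightarrow> 'a" where
  "prj M x = (SOME y. y \<in> M \<and> x - y \<in> M\<^sup>\<bottom>)"

locale closed_subspace =
  fixes M :: "'a::{real_inner, complete_space} set"
  assumes closed: "closed M" and subspace: "subspace M"
begin

lemma prj_in: "prj M x \<in> M" and prj_diff: "x - prj M x \<in> M\<^sup>\<bottom>"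
proof -
  have "\<exists>y. y \<in> M \<and> x - y \<in> M\<^sup>\<bottom>" using projection_exists[OF closed subspace] by blast
  from someI_ex[OF this] show "prj M x \<in> M" "x - prj M x \<in> M\<^sup>\<bottom>" by (auto simp: prj_def)
qed

lemma prj_eqI:
  assumes "y \<in> M" "x - y \<in> M\<^sup>\<bottom>"
  shows "prj M x = y"
proof -
  have "prj M x - y \<in> M" by (intro subspace_diff subspace prj_in assms)
  moreover have "(x - y) - (x - prj M x) \<in> M\<^sup>\<bottom>"
    by (intro subspace_diff[OF subspace_orthogonal_comp] assms prj_diff)
  ultimately show ?thesis using orth_self by fastforce
qed

lemma prj_id: "x \<in> M \<Longrightarrow> prj M x = x"
  by (rule prj_eqI) (simp_all add: orth_iff)

lemma prj_0: "x \<in> M\<^sup>\<bottom> \<Longrightarrow> prj M x = 0"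
  by (rule prj_eqI) (simp_all add: subspace_0[OF subspace])

lemma prj_fix_iff: "prj M x = x \<longleftrightarrow> x \<in> M"
  using prj_id prj_in by metis

lemma range_prj: "range (prj M) = M"
  using prj_id prj_in by (metis subsetI subset_antisym rangeI image_subset_iff)

lemma biorth: "M\<^sup>\<bottom>\<^sup>\<bottom> = M"
proof
  show "M\<^sup>\<bottom>\<^sup>\<bottom> \<subseteq> M"
  proof
    fix x assume x: "x \<in> M\<^sup>\<bottom>\<^sup>\<bottom>"
    have "prj M x \<in> M\<^sup>\<bottom>\<^sup>\<bottom>" using prj_in orthogonal_comp_subset by blast
    then have "x - prj M x \<in> M\<^sup>\<bottom>\<^sup>\<bottom>" by (intro subspace_diff[OF subspace_orthogonal_comp] x)
    then have "x - prj M x = 0" using prj_diff orth_self by blast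
    then show "x \<in> M" using prj_in by (metis eq_iff_diff_eq_0)
  qed
qed (rule orthogonal_comp_subset)

lemma inner_prj: "inner (prj M x) y = inner x (prj M y)"
proof -
  have "inner (prj M x) (y - prj M y) = 0" "inner (x - prj M x) (prj M y) = 0"
    using orthD[OF prj_diff prj_in] by auto
  then show ?thesis by (simp add: inner_diff)
qed

lemma inner_prj_self: "inner x (prj M x) = (norm (prj M x))\<^sup>2"
  by (metis inner_prj power2_norm_eq_inner prj_id prj_in)

lemma norm_prj_split: "(norm x)\<^sup>2 = (norm (prj M x))\<^sup>2 + (norm (x - prj M x))\<^sup>2"
  using norm_add_orth[OF orthD(1)[OF prj_diff[of x] prj_in[of x]]] by simp

lemma norm_prj: "norm (prj M x) \<le> norm x"
  by (rule power2_le_imp_le) (simp_all add: norm_prj_split[of x])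

lemma bounded_linear_prj: "bounded_linear (prj M)"
proof (rule bounded_linear_intro[where K=1])
  fix x y :: 'a and c :: real
  have "(x - prj M x) + (y - prj M y) \<in> M\<^sup>\<bottom>"
    by (intro subspace_add[OF subspace_orthogonal_comp] prj_diff)
  then show "prj M (x + y) = prj M x + prj M y"
    by (intro prj_eqI subspace_add[OF subspace] prj_in) (simp add: algebra_simps)
  have "c *\<^sub>R (x - prj M x) \<in> M\<^sup>\<bottom>"
    by (intro subspace_scale[OF subspace_orthogonal_comp] prj_diff)
  then show "prj M (c *\<^sub>R x) = c *\<^sub>R prj M x"
    by (intro prj_eqI subspace_scale[OF subspace] prj_in) (simp add: algebra_simps)
  show "norm (prj M x) \<le> norm x * 1" by (simp add: norm_prj)
qed

lemma prj_commute:
  assumes lin: "linear T" and inv: "\<And>x. x \<in> M \<Longrightarrow> T x \<in> M" "\<And>x. x \<in> M\<^sup>\<bottom> \<Longrightarrow> T x \<in> M\<^sup>\<bottom>"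
  shows "prj M (T x) = T (prj M x)"
  using inv(2)[OF prj_diff] by (intro prj_eqI inv prj_in) (simp add: linear_diff[OF lin])

lemma eq_UNIV_iff: "M = UNIV \<longleftrightarrow> M\<^sup>\<bottom> = {0}"
  using biorth by (metis orthogonal_comp_UNIV orthogonal_comp_null)

end

lemma prj_prj_subset:
  assumes "closed_subspace M" "closed_subspace N" "M \<subseteq> N"
  shows "prj M (prj N x) = prj M x" "prj N (prj M x) = prj M x"
proof -
  interpret M: closed_subspace M by fact
  interpret N: closed_subspace N by fact
  show "prj N (prj M x) = prj M x" using M.prj_in assms(3) by (intro N.prj_id) auto
  have "x - prj N x \<in> M\<^sup>\<bottom>" using N.prj_diff orth_antimono[OF assms(3)] by auto
  then have "prj M (x - prj N x) = 0" by (rule M.prj_0)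
  then show "prj M (prj N x) = prj M x" by (simp add: linear_diff[OF bounded_linear.linear[OF M.bounded_linear_prj]])
qed

text \<open>Membership becomes an equation between continuous maps, which is how the orthogonal sum
  is seen to be closed.\<close>

lemma mem_orth_sum_iff:
  assumes "closed_subspace M" "closed_subspace N" "N \<subseteq> M\<^sup>\<bottom>"
  shows "x \<in> {u + v |u v. u \<in> M \<and> v \<in> N} \<longleftrightarrow> x = prj M x + prj N x"
proof
  interpret M: closed_subspace M by fact
  interpret N: closed_subspace N by fact
  show "x = prj M x + prj N x" if "x \<in> {u + v |u v. u \<in> M \<and> v \<in> N}"
  proof -
    from that obtain u v where uv: "x = u + v" "u \<in> M" "v \<in> N" by auto
    have "v \<in> M\<^sup>\<bottom>" "u \<in> N\<^sup>\<bottom>" using uv assms(3) subset_orth_sym by blast+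
    then have "prj M x = u" "prj N x = v"
      using uv by (auto intro!: M.prj_eqI N.prj_eqI)
    then show ?thesis using uv by simp
  qed
  show "x \<in> {u + v |u v. u \<in> M \<and> v \<in> N}" if "x = prj M x + prj N x"
    using that M.prj_in[of x] N.prj_in[of x] by blast
qed

lemma closed_subspace_orth_sum:
  assumes "closed_subspace M" "closed_subspace N" "N \<subseteq> M\<^sup>\<bottom>"
  shows "closed_subspace {u + v |u v. u \<in> M \<and> v \<in> N}"
proof
  interpret M: closed_subspace M by fact
  interpret N: closed_subspace N by fact
  show "subspace {u + v |u v. u \<in> M \<and> v \<in> N}" by (rule subspace_sums[OF M.subspace N.subspace])
  have eq: "{u + v |u v. u \<in> M \<and> v \<in> N} = {x. x = prj M x + prj N x}"
    using mem_orth_sum_iff[OF assms] by blast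
  show "closed {u + v |u v. u \<in> M \<and> v \<in> N}"
    unfolding eq
    by (intro closed_Collect_eq continuous_intros
        linear_continuous_on[OF M.bounded_linear_prj] linear_continuous_on[OF N.bounded_linear_prj])
qed

section \<open>Positive operators and absolute values\<close>

text \<open>Symmetry for the real inner product, without \<open>J\<close>: absolute values and
  spectral comparisons are carried out over the reals.\<close>

definition selfadj :: "('a::real_inner \<Rightarrow> 'a) \<Rightarrow> bool" where
  "selfadj A \<longleftrightarrow> bounded_linear A \<and> (\<forall>x y. inner (A x) y = inner x (A y))"

lemma selfadj_linear: "selfadj A \<Longrightarrow> linear A"
  by (simp add: selfadj_def bounded_linear.linear)

lemma selfadj_inner: "selfadj A \<Longrightarrow> inner (A x) y = inner x (A y)"
  by (simp add: selfadj_def)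

lemma selfadj_id: "selfadj id"
  by (simp add: selfadj_def id_def)

lemma selfadj_add: "selfadj A \<Longrightarrow> selfadj B \<Longrightarrow> selfadj (\<lambda>x. A x + B x)"
  by (simp add: selfadj_def bounded_linear_add inner_add)

lemma selfadj_diff: "selfadj A \<Longrightarrow> selfadj B \<Longrightarrow> selfadj (\<lambda>x. A x - B x)"
  by (simp add: selfadj_def bounded_linear_sub inner_diff)

lemma selfadj_scale: "selfadj A \<Longrightarrow> selfadj (\<lambda>x. c *\<^sub>R A x)"
  by (simp add: selfadj_def bounded_linear_scaleR_right bounded_linear_const_scaleR)

lemma selfadj_scaleR: "selfadj (\<lambda>x. c *\<^sub>R x)"
  using selfadj_scale[OF selfadj_id, of c] by simp

lemma selfadj_sum: "(\<And>i. i \<in> I \<Longrightarrow> selfadj (T i)) \<Longrightarrow> selfadj (\<lambda>x. \<Sum>i\<in>I. T i x)"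
  by (simp add: selfadj_def bounded_linear_sum inner_sum_left inner_sum_right)

lemma selfadj_commuting_comp:
  assumes "selfadj A" "selfadj B" "\<And>x. A (B x) = B (A x)"
  shows "selfadj (\<lambda>x. A (B x))"
  using assms bounded_linear_compose[of A B] by (auto simp: selfadj_def)

lemma selfadj_bound:
  assumes "selfadj A"
  obtains K where "K > 0" "\<And>x. norm (A x) \<le> K * norm x" "\<And>x. \<bar>inner x (A x)\<bar> \<le> K * inner x x"
proof -
  have "bounded_linear A" using assms by (simp add: selfadj_def)
  from bounded_linear.pos_bounded[OF this] obtain K where K: "K > 0" "\<And>x. norm (A x) \<le> norm x * K"
    by blast
  moreover have "\<bar>inner x (A x)\<bar> \<le> K * inner x x" for x
  proof -
    have "\<bar>inner x (A x)\<bar> \<le> norm x * norm (A x)" by (rule Cauchy_Schwarz_ineq2)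
    also have "\<dots> \<le> norm x * (norm x * K)" by (intro mult_left_mono K) simp
    finally show ?thesis by (simp add: power2_norm_eq_inner[symmetric] power2_eq_square algebra_simps)
  qed
  ultimately show ?thesis using that by (auto simp: mult.commute)
qed

lemma selfadj_orth_invariant:
  assumes "selfadj A" "\<And>x. x \<in> M \<Longrightarrow> A x \<in> M" "x \<in> M\<^sup>\<bottom>"
  shows "A x \<in> M\<^sup>\<bottom>"
  using assms by (auto simp: orth_iff simp flip: selfadj_inner)

lemma selfadj_eqI:
  assumes "selfadj A" "selfadj B" "\<And>x. inner x (A x) = inner x (B x)"
  shows "A = B"
proof
  fix x
  define D where "D = (\<lambda>x. A x - B x)"
  have D: "selfadj D" unfolding D_def by (intro selfadj_diff assms)
  have q: "inner x (D x) = 0" for x by (simp add: D_def inner_diff assms)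
  \<comment> \<open>Polarization at the single vector x + D x: the diagonal terms vanish and the
    mixed ones add up to twice the squared norm of \<open>D x\<close>.\<close>
  have "inner (x + D x) (D (x + D x)) = 2 * inner (D x) (D x)"
    using selfadj_inner[OF D, of x "D x"] q[of x] q[of "D x"]
    by (simp add: linear_add[OF selfadj_linear[OF D]] inner_add)
  then have "D x = 0" using q by simp
  then show "A x = B x" by (simp add: D_def)
qed

text \<open>Nonnegativity is tested at x - A x / r, and the upper bound is applied at
  \<open>A x\<close>. Everything is relative to an invariant subspace because the comparison of
  spectral subspaces has its upper bound only there.\<close>

lemma selfadj_norm_le:
  assumes A: "selfadj A" and M: "\<And>x. x \<in> M \<Longrightarrow> A x \<in> M" "subspace M" "x \<in> M"
    and pos: "\<And>x. x \<in> M \<Longrightarrow> 0 \<le> inner x (A x)" and le: "\<And>x. x \<in> M \<Longrightarrow> inner x (A x) \<le> r * inner x x"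
    and "r > 0"
  shows "(norm (A x))\<^sup>2 \<le> r * inner x (A x)" and "norm (A x) \<le> r * norm x"
proof -
  note lin = selfadj_linear[OF A]
  have "x - (1/r) *\<^sub>R A x \<in> M" by (intro subspace_diff subspace_scale M)
  then have "0 \<le> inner (x - (1/r) *\<^sub>R A x) (A (x - (1/r) *\<^sub>R A x))" by (rule pos)
  also have "\<dots> = inner x (A x) - 2 * (1/r) * inner (A x) (A x) + (1/r)\<^sup>2 * inner (A x) (A (A x))"
    using selfadj_inner[OF A, of x "A x"]
    by (simp add: linear_diff[OF lin] linear_scale[OF lin] inner_diff power2_eq_square algebra_simps)
  also have "\<dots> \<le> inner x (A x) - 2 * (1/r) * inner (A x) (A x) + (1/r)\<^sup>2 * (r * inner (A x) (A x))"
    by (intro add_left_mono mult_left_mono le M) simp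
  also have "\<dots> = inner x (A x) - (norm (A x))\<^sup>2 / r"
    using \<open>r > 0\<close> by (simp add: power2_norm_eq_inner) (simp add: power2_eq_square)
  finally show 1: "(norm (A x))\<^sup>2 \<le> r * inner x (A x)"
    using \<open>r > 0\<close> by (simp add: field_simps)
  also have "\<dots> \<le> r * (r * inner x x)" using \<open>r > 0\<close> by (intro mult_left_mono le M) simp
  also have "\<dots> = (r * norm x)\<^sup>2" by (simp add: power_mult_distrib dot_square_norm) (simp add: power2_eq_square)
  finally show "norm (A x) \<le> r * norm x"
    by (rule power2_le_imp_le) (use \<open>r > 0\<close> in simp)
qed

lemma selfadj_norm_le_UNIV:
  assumes "selfadj A" "\<And>x. 0 \<le> inner x (A x)" "\<And>x. inner x (A x) \<le> r * inner x x" "r > 0"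
  shows "(norm (A x))\<^sup>2 \<le> r * inner x (A x)" "norm (A x) \<le> r * norm x"
  using selfadj_norm_le[of A UNIV x r] assms by auto

text \<open>The quadratic forms converge as bounded increasing sequences. Strong convergence follows
  because the squared norm of (T m - T n) x is at most K times the difference of the forms at
  \<open>x\<close>, for n \<le> m.\<close>

lemma selfadj_incseq_converges:
  fixes T :: "nat \<Rightarrow> 'a::{real_inner, complete_space} \<Rightarrow> 'a"
  assumes sa: "\<And>n. selfadj (T n)" and pos: "\<And>n x. 0 \<le> inner x (T n x)"
    and le: "\<And>n x. inner x (T n x) \<le> K * inner x x" and "K > 0"
    and inc: "\<And>n x. inner x (T n x) \<le> inner x (T (Suc n) x)"
  obtains L where "selfadj L" "\<And>x. (\<lambda>n. T n x) \<longlonglongrightarrow> L x"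
proof -
  have mono: "inner x (T m x) \<le> inner x (T n x)" if "m \<le> n" for m n x
    using that by (rule lift_Suc_mono_le[of "\<lambda>n. inner x (T n x)", OF inc])
  have "Cauchy (\<lambda>n. T n x)" for x
  proof (rule CauchyI)
    fix e :: real assume e: "e > 0"
    have "incseq (\<lambda>n. inner x (T n x))" using mono by (auto simp: incseq_def)
    then have "convergent (\<lambda>n. inner x (T n x))"
      using le by (auto intro: incseq_convergent simp: convergent_def)
    then have "Cauchy (\<lambda>n. inner x (T n x))" by (rule convergent_Cauchy)
    moreover have "e\<^sup>2 / K > 0" using e \<open>K > 0\<close> by simp
    ultimately obtain N where N: "\<And>m n. m \<ge> N \<Longrightarrow> n \<ge> N \<Longrightarrow> norm (inner x (T m x) - inner x (T n x)) < e\<^sup>2 / K"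
      by (meson CauchyD)
    have *: "norm (T m x - T n x) < e" if "m \<ge> N" "n \<ge> N" "n \<le> m" for m n
    proof -
      have "(norm (T m x - T n x))\<^sup>2 \<le> K * inner x (T m x - T n x)"
      proof (rule selfadj_norm_le_UNIV(1)[where A="\<lambda>x. T m x - T n x"])
        show "selfadj (\<lambda>x. T m x - T n x)" by (intro selfadj_diff sa)
        show "0 \<le> inner y (T m y - T n y)" for y
          using mono[OF \<open>n \<le> m\<close>, of y] by (simp add: inner_diff)
        show "inner y (T m y - T n y) \<le> K * inner y y" for y
          using le[of y m] pos[of y n] by (simp add: inner_diff)
      qed fact
      also have "\<dots> < K * (e\<^sup>2 / K)"
        using N[OF that(1,2)] \<open>K > 0\<close> by (intro mult_strict_left_mono) (auto simp: inner_diff)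
      also have "\<dots> = e\<^sup>2" using \<open>K > 0\<close> by simp
      finally show ?thesis using e by (simp add: power2_less_imp_less)
    qed
    have "norm (T m x - T n x) < e" if "m \<ge> N" "n \<ge> N" for m n
      using *[of m n] *[of n m] that by (cases "n \<le> m") (auto simp: norm_minus_commute)
    then show "\<exists>N. \<forall>m\<ge>N. \<forall>n\<ge>N. norm (T m x - T n x) < e" by blast
  qed
  then have "\<exists>y. (\<lambda>n. T n x) \<longlonglongrightarrow> y" for x using Cauchy_convergent convergent_def by blast
  then obtain L where L: "\<And>x. (\<lambda>n. T n x) \<longlonglongrightarrow> L x" by metis
  have "selfadj L"
    unfolding selfadj_def
  proof (intro conjI allI)
    show "bounded_linear L"
    proof (rule bounded_linear_intro[where K=K])
      fix x y :: 'a and c :: real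
      have "(\<lambda>n. T n (x + y)) \<longlonglongrightarrow> L x + L y"
        using tendsto_add[OF L[of x] L[of y]] by (simp add: linear_add[OF selfadj_linear[OF sa]])
      then show "L (x + y) = L x + L y" using LIMSEQ_unique L by blast
      have "(\<lambda>n. T n (c *\<^sub>R x)) \<longlonglongrightarrow> c *\<^sub>R L x"
        using tendsto_scaleR[OF tendsto_const L[of x]] by (simp add: linear_scale[OF selfadj_linear[OF sa]])
      then show "L (c *\<^sub>R x) = c *\<^sub>R L x" using LIMSEQ_unique L by blast
      have "norm (T n x) \<le> norm x * K" for n
        using selfadj_norm_le_UNIV(2)[OF sa pos le \<open>K > 0\<close>] by (simp add: mult.commute)
      then show "norm (L x) \<le> norm x * K"
        by (intro LIMSEQ_le_const2[OF tendsto_norm[OF L]]) auto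
    qed
    show "inner (L x) y = inner x (L y)" for x y
      using LIMSEQ_unique[OF tendsto_inner[OF L[of x] tendsto_const[of y]]
          tendsto_inner[OF tendsto_const[of x] L[of y], folded selfadj_inner[OF sa]]] .
  qed
  then show ?thesis using that L by blast
qed

text \<open>The operators \<open>p(Z)\<close> for polynomials \<open>p\<close> with nonnegative coefficients.\<close>

inductive_set poly_cone :: "('a::real_inner \<Rightarrow> 'a) \<Rightarrow> ('a \<Rightarrow> 'a) set" for Z where
  zero: "(\<lambda>x. 0) \<in> poly_cone Z"
| ident: "(\<lambda>x. x) \<in> poly_cone Z"
| mult: "X \<in> poly_cone Z \<Longrightarrow> (\<lambda>x. Z (X x)) \<in> poly_cone Z"
| add: "X \<in> poly_cone Z \<Longrightarrow> Y \<in> poly_cone Z \<Longrightarrow> (\<lambda>x. X x + Y x) \<in> poly_cone Z"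
| scale: "X \<in> poly_cone Z \<Longrightarrow> c \<ge> 0 \<Longrightarrow> (\<lambda>x. c *\<^sub>R X x) \<in> poly_cone Z"

lemma poly_cone_comp:
  assumes "X \<in> poly_cone Z" "Y \<in> poly_cone Z"
  shows "(\<lambda>x. X (Y x)) \<in> poly_cone Z"
  using assms(1)
proof (induction rule: poly_cone.induct)
  case (mult X)
  show ?case by (rule poly_cone.mult[OF mult.IH])
next
  case (add X X')
  show ?case by (rule poly_cone.add[OF add.IH])
next
  case (scale X c)
  show ?case by (rule poly_cone.scale[OF scale.IH scale.hyps(2)])
qed (simp_all add: poly_cone.zero assms(2))

lemma poly_cone_commute:
  assumes "X \<in> poly_cone Z" "linear S" "\<And>x. S (Z x) = Z (S x)"
  shows "S (X x) = X (S x)"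
  using assms(1)
  by (induction arbitrary: x rule: poly_cone.induct)
    (simp_all add: assms(3) linear_0[OF assms(2)] linear_add[OF assms(2)] linear_scale[OF assms(2)])

lemma poly_cone_selfadj:
  assumes "X \<in> poly_cone Z" "selfadj Z"
  shows "selfadj X"
  using assms(1)
proof (induction rule: poly_cone.induct)
  case (mult X)
  show ?case
    by (rule selfadj_commuting_comp[OF assms(2) mult.IH])
      (rule poly_cone_commute[OF mult.hyps selfadj_linear[OF assms(2)] refl])
next
  case (add X Y)
  show ?case by (rule selfadj_add[OF add.IH])
next
  case (scale X c)
  show ?case by (rule selfadj_scale[OF scale.IH])
qed (simp_all add: selfadj_def)

text \<open>The induction must carry Z X along with X: multiplication by \<open>Z\<close> raises the
  degree by one, while the available argument, <x, Z Z X x> = <Z x, X Z x>, raises it by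
  two.\<close>

lemma poly_cone_nonneg_aux:
  assumes "X \<in> poly_cone Z" "selfadj Z" "\<And>x. 0 \<le> inner x (Z x)"
  shows "0 \<le> inner x (X x) \<and> 0 \<le> inner x (Z (X x))"
  using assms(1)
proof (induction arbitrary: x rule: poly_cone.induct)
  case (mult X)
  have "inner x (Z (Z (X x))) = inner (Z x) (X (Z x))"
    by (simp only: selfadj_inner[OF assms(2)] poly_cone_commute[OF mult.hyps selfadj_linear[OF assms(2)] refl])
  then show ?case using mult.IH by auto
next
  case (add X Y)
  then show ?case by (simp add: linear_add[OF selfadj_linear[OF assms(2)]] inner_add)
next
  case (scale X c)
  then show ?case by (simp add: linear_scale[OF selfadj_linear[OF assms(2)]])
qed (use assms(3) in \<open>simp_all add: linear_0[OF selfadj_linear[OF assms(2)]]\<close>)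

lemma poly_cone_nonneg:
  "X \<in> poly_cone Z \<Longrightarrow> selfadj Z \<Longrightarrow> (\<And>x. 0 \<le> inner x (Z x)) \<Longrightarrow> 0 \<le> inner x (X x)"
  by (rule conjunct1[OF poly_cone_nonneg_aux])

text \<open>The iteration \<open>Y \<mapsto> (Z + Y\<^sup>2)/2\<close> increases to \<open>I - \<bar>S\<bar>\<close>, where \<open>Z = I - S\<^sup>2\<close>; each difference of
  consecutive iterates is a polynomial in \<open>Z\<close> with nonnegative coefficients.\<close>

primrec sqrt_iter :: "('a::real_inner \<Rightarrow> 'a) \<Rightarrow> nat \<Rightarrow> 'a \<Rightarrow> 'a" where
  "sqrt_iter Z 0 = (\<lambda>x. 0)"
| "sqrt_iter Z (Suc n) = (\<lambda>x. (1/2) *\<^sub>R (Z x + sqrt_iter Z n (sqrt_iter Z n x)))"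

lemma cone_Z: "Z \<in> poly_cone Z"
  using poly_cone.mult[OF poly_cone.ident, of Z] by simp

lemma sqrt_iter_cone: "sqrt_iter Z n \<in> poly_cone Z"
proof (induction n)
  case (Suc n)
  have "(\<lambda>x. (1/2) *\<^sub>R (Z x + sqrt_iter Z n (sqrt_iter Z n x))) \<in> poly_cone Z"
    by (intro poly_cone.scale poly_cone.add cone_Z poly_cone_comp[OF Suc Suc]) simp
  then show ?case by simp
qed (simp add: poly_cone.zero)

lemma sqrt_iter_step:
  assumes "selfadj Z"
  shows "(\<lambda>x. sqrt_iter Z (Suc n) x - sqrt_iter Z n x) \<in> poly_cone Z"
proof (induction n)
  case 0
  show ?case using poly_cone.scale[OF cone_Z, of "1/2"] by simp
next
  case (Suc n)
  let ?Y = "sqrt_iter Z"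
  let ?D = "\<lambda>x. ?Y (Suc n) x - ?Y n x"
  have lin: "linear (?Y k)" for k
    by (intro selfadj_linear poly_cone_selfadj[OF sqrt_iter_cone] assms)
  \<comment> \<open>For consecutive iterates Y, Y' the difference of squares is Y' (Y' - Y) + (Y' -
    Y) Y, a sum of products of cone elements.\<close>
  have "(\<lambda>x. (1/2) *\<^sub>R (?Y (Suc n) (?D x) + ?D (?Y n x))) \<in> poly_cone Z"
    by (rule poly_cone.scale[OF poly_cone.add[OF poly_cone_comp[OF sqrt_iter_cone Suc]
            poly_cone_comp[OF Suc sqrt_iter_cone]]]) simp
  also have "(\<lambda>x. (1/2) *\<^sub>R (?Y (Suc n) (?D x) + ?D (?Y n x))) = (\<lambda>x. ?Y (Suc (Suc n)) x - ?Y (Suc n) x)"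
  proof
    fix x
    have "?Y (Suc (Suc n)) x = (1/2) *\<^sub>R (Z x + ?Y (Suc n) (?Y (Suc n) x))"
      by (rule fun_cong[OF sqrt_iter.simps(2)])
    moreover have "?Y (Suc n) x = (1/2) *\<^sub>R (Z x + ?Y n (?Y n x))"
      by (rule fun_cong[OF sqrt_iter.simps(2)])
    ultimately have "?Y (Suc (Suc n)) x - ?Y (Suc n) x =
        (1/2) *\<^sub>R (?Y (Suc n) (?Y (Suc n) x) - ?Y n (?Y n x))"
      by (simp only: scaleR_right_diff_distrib[symmetric] add_diff_cancel_left)
    then show "(1/2) *\<^sub>R (?Y (Suc n) (?D x) + ?D (?Y n x)) = ?Y (Suc (Suc n)) x - ?Y (Suc n) x"
      by (simp only: linear_diff[OF lin] diff_add_cancel add_diff_eq)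
  qed
  finally show ?case .
qed

text \<open>The limit \<open>L\<close> of the iteration satisfies L = (Z + L^2)/2, that is (I - L)^2
  = I - Z = S^2. So I - L is a square root of S^2; it is positive because the iterates are
  contractions and commutes with \<open>S\<close> because polynomials in \<open>Z\<close>
  do.\<close>

lemma abs_operator_contraction:
  fixes S :: "'a::{real_inner, complete_space} \<Rightarrow> 'a"
  assumes S: "selfadj S" and S1: "\<And>x. norm (S x) \<le> norm x"
  obtains R where "selfadj R" "\<And>x. 0 \<le> inner x (R x)" "\<And>x. R (R x) = S (S x)" "\<And>x. R (S x) = S (R x)"
proof -
  note linS = selfadj_linear[OF S]
  define Z where "Z = (\<lambda>x. x - S (S x))"
  have Z: "selfadj Z"
    unfolding Z_def using selfadj_diff[OF selfadj_id selfadj_commuting_comp[OF S S]] by simp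
  have SZ: "S (Z x) = Z (S x)" for x by (simp add: Z_def linear_diff[OF linS])
  have SS: "inner x (S (S x)) = (norm (S x))\<^sup>2" for x
    by (simp add: selfadj_inner[OF S, symmetric] power2_norm_eq_inner)
  have Zpos: "0 \<le> inner x (Z x)" for x
    using power_mono[OF S1[of x] norm_ge_zero, of 2]
    by (simp add: Z_def inner_diff SS power2_norm_eq_inner)
  have Znorm: "norm (Z x) \<le> norm x" for x
  proof (rule power2_le_imp_le)
    have "(norm (Z x))\<^sup>2 = (norm x)\<^sup>2 - 2 * inner x (S (S x)) + (norm (S (S x)))\<^sup>2"
      by (simp add: Z_def power2_norm_eq_inner inner_diff inner_commute)
    also have "\<dots> \<le> (norm x)\<^sup>2"
      using power_mono[OF S1[of "S x"] norm_ge_zero, of 2] zero_le_power2[of "norm (S x)"] unfolding SS by linarith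
    finally show "(norm (Z x))\<^sup>2 \<le> (norm x)\<^sup>2" .
  qed simp
  let ?Y = "sqrt_iter Z"
  have Y: "selfadj (?Y n)" for n by (intro poly_cone_selfadj[OF sqrt_iter_cone] Z)
  have Ynorm: "norm (?Y n x) \<le> norm x" for n x
  proof (induction n arbitrary: x)
    case (Suc n)
    have "norm (Z x + ?Y n (?Y n x)) \<le> norm (Z x) + norm (?Y n (?Y n x))" by (rule norm_triangle_ineq)
    also have "\<dots> \<le> norm x + norm x"
      using Znorm[of x] Suc[of "?Y n x"] Suc[of x] by linarith
    finally show ?case by simp
  qed simp
  have Yle: "inner x (?Y n x) \<le> 1 * inner x x" for n x
    using norm_cauchy_schwarz[of x "?Y n x"] mult_left_mono[OF Ynorm[of n x], of "norm x"]
    by (simp add: power2_norm_eq_inner[symmetric] power2_eq_square)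
  have Yinc: "inner x (?Y n x) \<le> inner x (?Y (Suc n) x)" for n x
    using poly_cone_nonneg[OF sqrt_iter_step[OF Z] Z Zpos, of x n] by (simp add: inner_diff del: sqrt_iter.simps)
  obtain L where L: "selfadj L" "\<And>x. (\<lambda>n. ?Y n x) \<longlonglongrightarrow> L x"
    using selfadj_incseq_converges[of ?Y 1, OF Y poly_cone_nonneg[OF sqrt_iter_cone Z Zpos] Yle zero_less_one Yinc]
    by blast
  have YY: "(\<lambda>n. ?Y n (?Y n x)) \<longlonglongrightarrow> L (L x)" for x
  proof -
    \<comment> \<open>As the iterates are contractions, replacing the inner iterate by its limit
      costs only a vector tending to 0.\<close>
    have "(\<lambda>n. ?Y n (?Y n x - L x)) \<longlonglongrightarrow> 0"
    proof (rule tendsto_norm_zero_cancel, rule tendsto_sandwich[OF _ _ tendsto_const])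
      show "(\<lambda>n. norm (?Y n x - L x)) \<longlonglongrightarrow> 0"
        using L(2)[of x] by (simp add: LIM_zero tendsto_norm_zero)
    qed (use Ynorm in auto)
    from tendsto_add[OF this L(2)[of "L x"]] show ?thesis
      by (simp add: linear_diff[OF selfadj_linear[OF Y]])
  qed
  have LL: "L x = (1/2) *\<^sub>R (Z x + L (L x))" for x
  proof (rule LIMSEQ_unique)
    show "(\<lambda>n. ?Y (Suc n) x) \<longlonglongrightarrow> L x" using L(2)[of x] by (rule LIMSEQ_Suc)
    show "(\<lambda>n. ?Y (Suc n) x) \<longlonglongrightarrow> (1/2) *\<^sub>R (Z x + L (L x))"
      unfolding sqrt_iter.simps by (intro tendsto_scaleR tendsto_add tendsto_const YY)
  qed
  define R where "R = (\<lambda>x. x - L x)"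
  show ?thesis
  proof (rule that[of R])
    show "selfadj R" unfolding R_def using selfadj_diff[OF selfadj_id L(1)] by simp
    show "0 \<le> inner x (R x)" for x
    proof -
      have "inner x (L x) \<le> inner x x"
        using Yle by (intro LIMSEQ_le_const2[OF tendsto_inner[OF tendsto_const L(2)]]) auto
      then show ?thesis by (simp add: R_def inner_diff)
    qed
    show "R (R x) = S (S x)" for x
    proof -
      have "2 *\<^sub>R L x = Z x + L (L x)" by (subst LL) simp
      then have "L x + L x = x - S (S x) + L (L x)" by (simp add: Z_def scaleR_2)
      then show ?thesis by (simp add: R_def linear_diff[OF selfadj_linear[OF L(1)]] algebra_simps)
    qed
    show "R (S x) = S (R x)" for x
    proof -
      have "(\<lambda>n. S (?Y n x)) \<longlonglongrightarrow> S (L x)"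
        using S L(2) by (auto simp: selfadj_def intro: bounded_linear.tendsto)
      then have "S (L x) = L (S x)"
        unfolding poly_cone_commute[where Z=Z and S=S, OF sqrt_iter_cone linS SZ] by (rule LIMSEQ_unique[OF _ L(2)])
      then show ?thesis by (simp add: R_def linear_diff[OF linS])
    qed
  qed
qed

lemma abs_operator:
  fixes S :: "'a::{real_inner, complete_space} \<Rightarrow> 'a"
  assumes S: "selfadj S"
  obtains R where "selfadj R" "\<And>x. 0 \<le> inner x (R x)" "\<And>x. R (R x) = S (S x)" "\<And>x. R (S x) = S (R x)"
proof -
  obtain K where K: "K > 0" "\<And>x. norm (S x) \<le> K * norm x" "\<And>x. \<bar>inner x (S x)\<bar> \<le> K * inner x x"
    by (rule selfadj_bound[OF S]) (rule that)
  let ?S = "\<lambda>x. (1/K) *\<^sub>R S x"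
  have "norm (?S x) \<le> norm x" for x using K(2)[of x] K(1) by (simp add: field_simps)
  then obtain R where R: "selfadj R" "\<And>x. 0 \<le> inner x (R x)" "\<And>x. R (R x) = ?S (?S x)" "\<And>x. R (?S x) = ?S (R x)"
    by (rule abs_operator_contraction[OF selfadj_scale[OF S]]) (rule that)
  have RR: "K *\<^sub>R R (K *\<^sub>R R x) = S (S x)" for x
    using R(3)[of x] K(1) by (simp add: linear_scale[OF selfadj_linear[OF R(1)]] linear_scale[OF selfadj_linear[OF S]])
  have RS: "K *\<^sub>R R (S x) = S (K *\<^sub>R R x)" for x
    using R(4)[of x] K(1) by (simp add: linear_scale[OF selfadj_linear[OF R(1)]] linear_scale[OF selfadj_linear[OF S]])
  show ?thesis
    using RR RS K(1) R(2) by (intro that[of "\<lambda>x. K *\<^sub>R R x"] selfadj_scale R(1)) auto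
qed

text \<open>The witness is the kernel of the positive part of \<open>S\<close>.\<close>

lemma sign_split:
  fixes S :: "'a::{real_inner, complete_space} \<Rightarrow> 'a"
  assumes S: "selfadj S"
  obtains K where "closed_subspace K" "\<And>x. x \<in> K \<Longrightarrow> S x \<in> K"
    "\<And>x. x \<in> K \<Longrightarrow> inner x (S x) \<le> 0" "\<And>x. x \<in> K\<^sup>\<bottom> \<Longrightarrow> 0 \<le> inner x (S x)"
proof -
  obtain R where R: "selfadj R" "\<And>x. 0 \<le> inner x (R x)" "\<And>x. R (R x) = S (S x)" "\<And>x. R (S x) = S (R x)"
    by (rule abs_operator[OF S]) (rule that)
  note linR = selfadj_linear[OF R(1)] and linS = selfadj_linear[OF S]
  define K where "K = {x. R x + S x = 0}"
  have bl: "bounded_linear (\<lambda>x. R x + S x)" using selfadj_add[OF R(1) S] by (simp add: selfadj_def)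
  have K: "closed_subspace K"
  proof
    show "closed K" unfolding K_def
      by (intro closed_Collect_eq continuous_intros linear_continuous_on[OF bl])
    show "subspace K" unfolding K_def
      using linear_subspace_kernel[OF bounded_linear.linear[OF bl]] by simp
  qed
  have KS: "S x \<in> K" and KR: "R x \<in> K" if "x \<in> K" for x
  proof -
    have "S (R x + S x) = 0" "R (R x + S x) = 0"
      using that by (simp_all add: K_def linear_0[OF linS] linear_0[OF linR])
    then show "S x \<in> K" "R x \<in> K"
      by (simp_all add: K_def R linear_add[OF linS] linear_add[OF linR] add.commute)
  qed
  \<comment> \<open>R - S is twice the negative part of \<open>S\<close>, and (R + S)(R - S) = R^2 -
    S^2 = 0 puts its range into \<open>K\<close>. On the complement of \<open>K\<close> its values
    lie in \<open>K\<close> and in the complement, so R = S there.\<close>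
  have KD: "R x - S x \<in> K" for x
    by (simp add: K_def linear_diff[OF linS] linear_diff[OF linR] R)
  show ?thesis
  proof (rule that[OF K KS])
    show "inner x (S x) \<le> 0" if "x \<in> K" for x
    proof -
      have "S x = - R x" using that by (simp add: K_def eq_neg_iff_add_eq_0 add.commute)
      then show ?thesis using R(2) by simp
    qed
    show "0 \<le> inner x (S x)" if "x \<in> K\<^sup>\<bottom>" for x
    proof -
      have "R x - S x \<in> K\<^sup>\<bottom>"
        using selfadj_orth_invariant[OF selfadj_diff[OF R(1) S], of K x] KD that by auto
      then have "R x = S x" using KD orth_self by fastforce
      then show ?thesis using R(2)[of x] by simp
    qed
  qed
qed

section \<open>Spectral subspaces\<close>

definition csub :: "('a::real_inner \<Rightarrow> 'a) \<Rightarrow> 'a set \<Rightarrow> bool" where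
  "csub J M \<longleftrightarrow> closed M \<and> subspace M \<and> (\<forall>x\<in>M. J x \<in> M)"

text \<open>The ranges of a spectral family, with no operator attached. Right-continuity is an
  inclusion of sets; strong continuity of the projections is derived from it.\<close>

definition resolution :: "('a::real_inner \<Rightarrow> 'a) \<Rightarrow> (real \<Rightarrow> 'a set) \<Rightarrow> bool" where
  "resolution J F \<longleftrightarrow> (\<forall>t. csub J (F t)) \<and> (\<forall>s t. s \<le> t \<longrightarrow> F s \<subseteq> F t) \<and>
     (\<forall>t. (\<Inter>s\<in>{t<..}. F s) \<subseteq> F t) \<and> (\<exists>a b. (\<forall>t<a. F t = {0}) \<and> (\<forall>t\<ge>b. F t = UNIV))"

text \<open>Stands in for the integral formula. Invariance is asked of \<open>F t\<close> only; for
  a self-adjoint operator the complement is then invariant as well.\<close>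

definition represents :: "('a::real_inner \<Rightarrow> 'a) \<Rightarrow> (real \<Rightarrow> 'a set) \<Rightarrow> bool" where
  "represents A F \<longleftrightarrow> (\<forall>t. (\<forall>x\<in>F t. A x \<in> F t \<and> inner x (A x) \<le> t * inner x x) \<and>
     (\<forall>x\<in>(F t)\<^sup>\<bottom>. t * inner x x \<le> inner x (A x)))"

lemma csub_closed_subspace: "csub J M \<Longrightarrow> closed_subspace M"
  by (simp add: csub_def closed_subspace_def)

lemma resolution_csub: "resolution J F \<Longrightarrow> csub J (F t)"
  and resolution_mono: "resolution J F \<Longrightarrow> s \<le> t \<Longrightarrow> F s \<subseteq> F t"
  and resolution_right: "resolution J F \<Longrightarrow> (\<And>s. t < s \<Longrightarrow> x \<in> F s) \<Longrightarrow> x \<in> F t"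
  by (simp_all add: resolution_def) blast

lemma resolution_closed_subspace: "resolution J F \<Longrightarrow> closed_subspace (F t)"
  using csub_closed_subspace resolution_csub by blast

lemma resolution_bounds:
  assumes "resolution J F"
  obtains a b where "a < b" "\<And>t. t \<le> a \<Longrightarrow> F t = {0}" "\<And>t. b \<le> t \<Longrightarrow> F t = UNIV"
proof -
  obtain a b where ab: "\<And>t. t < a \<Longrightarrow> F t = {0}" "\<And>t. b \<le> t \<Longrightarrow> F t = UNIV"
    using assms by (auto simp: resolution_def)
  \<comment> \<open>Passing to a - 1 turns vanishing for t < a into vanishing up to and including
    the lower bound, and with the maximum it makes the two bounds strictly ordered.\<close>
  show ?thesis by (rule that[of "a - 1" "max a b"]) (simp_all add: ab)
qed

text \<open>An isometry with square -I is skew, \<open>inner y (J x) = - inner (J y) x\<close>, so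
  the real orthogonal complement of a complex subspace is again complex.\<close>

lemma csub_orth:
  assumes J: "complex_structure J" and M: "csub J M"
  shows "csub J (M\<^sup>\<bottom>)"
proof -
  have "inner y (J x) = 0" if "x \<in> M\<^sup>\<bottom>" "y \<in> M" for x y
  proof -
    have JJ: "J (J x) = - x" and iso: "inner (J y) (J (J x)) = inner y (J x)"
      using J unfolding complex_structure_def by blast+
    have "inner y (J x) = - inner (J y) x" using iso unfolding JJ by simp
    also have "inner (J y) x = 0" using that M by (auto intro!: orthD(1)[of x M] simp: csub_def)
    finally show ?thesis by simp
  qed
  then show ?thesis by (auto simp: csub_def csubspace_orth orth_iff)
qed

lemma prj_J_commute:
  fixes M :: "'a::{real_inner, complete_space} set"
  assumes J: "complex_structure J" and M: "csub J M"
  shows "prj M (J x) = J (prj M x)"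
  using J M csub_orth[OF J M]
  by (intro closed_subspace.prj_commute csub_closed_subspace[OF M]) (auto simp: csub_def complex_structure_def)

lemma selfadj_prj: "closed_subspace M \<Longrightarrow> selfadj (prj M)"
  by (simp add: selfadj_def closed_subspace.bounded_linear_prj closed_subspace.inner_prj)

text \<open>On \<open>M\<close> the powers of \<open>A + c\<close> grow at most like \<open>(t + c)\<^sup>n\<close>, on the orthogonal complement of \<open>N\<close> at least
  like \<open>(s + c)\<^sup>n\<close>.\<close>

lemma spectral_compare:
  fixes A :: "'a::{real_inner, complete_space} \<Rightarrow> 'a"
  assumes A: "selfadj A" and M: "subspace M" "\<And>x. x \<in> M \<Longrightarrow> A x \<in> M"
    and Mle: "\<And>x. x \<in> M \<Longrightarrow> inner x (A x) \<le> t * inner x x"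
    and N: "closed_subspace N" "\<And>x. x \<in> N \<Longrightarrow> A x \<in> N"
    and Nge: "\<And>x. x \<in> N\<^sup>\<bottom> \<Longrightarrow> s * inner x x \<le> inner x (A x)"
    and "t < s"
  shows "M \<subseteq> N"
proof
  fix x assume x: "x \<in> M"
  interpret N: closed_subspace N by fact
  obtain K where K: "K > 0" "\<And>x. norm (A x) \<le> K * norm x" "\<And>x. \<bar>inner x (A x)\<bar> \<le> K * inner x x"
    by (rule selfadj_bound[OF A]) (rule that)
  \<comment> \<open>The summand \<open>K\<close> makes A + c nonnegative on the whole space, and
    \<bar>t\<bar> + 1 makes t + c positive, so that the growth bounds can be iterated.\<close>
  define c where "c = K + \<bar>t\<bar> + 1"
  define B where "B = (\<lambda>x. A x + c *\<^sub>R x)"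
  have B: "selfadj B" unfolding B_def by (intro selfadj_add A selfadj_scaleR)
  have tc: "0 < t + c" and sc: "t + c < s + c" using K(1) \<open>t < s\<close> by (auto simp: c_def)
  have BM: "B x \<in> M" if "x \<in> M" for x
    unfolding B_def by (intro subspace_add subspace_scale M that)
  have BN: "B x \<in> N" if "x \<in> N" for x
    unfolding B_def by (intro subspace_add subspace_scale N.subspace N that)
  have BN': "B x \<in> N\<^sup>\<bottom>" if "x \<in> N\<^sup>\<bottom>" for x
    using selfadj_orth_invariant[OF B BN that] .
  have Bpos: "0 \<le> inner y (B y)" for y
  proof -
    have "\<bar>inner y (A y)\<bar> \<le> c * inner y y"
      using K(3)[of y] by (rule order_trans) (auto intro!: mult_right_mono simp: c_def)
    then show ?thesis by (simp add: B_def inner_add)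
  qed
  have Bup: "norm (B y) \<le> (t + c) * norm y" if "y \<in> M" for y
  proof (rule selfadj_norm_le(2)[OF B BM M(1) that Bpos _ tc])
    show "inner y (B y) \<le> (t + c) * inner y y" if "y \<in> M" for y
      using Mle[OF that] by (simp add: B_def inner_add algebra_simps)
  qed auto
  have Blo: "(s + c) * norm y \<le> norm (B y)" if "y \<in> N\<^sup>\<bottom>" for y
  proof (cases "y = 0")
    case False
    have "(s + c) * (norm y * norm y) \<le> inner y (B y)"
      using Nge[OF that] by (simp add: B_def inner_add algebra_simps flip: power2_eq_square power2_norm_eq_inner)
    also have "\<dots> \<le> norm y * norm (B y)" by (rule norm_cauchy_schwarz)
    finally have "norm y * ((s + c) * norm y) \<le> norm y * norm (B y)" by (simp add: mult_ac)
    then show ?thesis using False by simp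
  qed simp
  define y where "y = x - prj N x"
  have yN: "y \<in> N\<^sup>\<bottom>" unfolding y_def by (rule N.prj_diff)
  have up: "(B ^^ n) x \<in> M \<and> norm ((B ^^ n) x) \<le> (t + c) ^ n * norm x" for n
  proof (induction n)
    case (Suc n)
    have "norm (B ((B ^^ n) x)) \<le> (t + c) * norm ((B ^^ n) x)" using Suc Bup by blast
    also have "\<dots> \<le> (t + c) * ((t + c) ^ n * norm x)" using Suc tc by (intro mult_left_mono) auto
    finally show ?case using Suc BM by (simp add: mult.assoc)
  qed (simp add: x)
  have lo: "(B ^^ n) y \<in> N\<^sup>\<bottom> \<and> (s + c) ^ n * norm y \<le> norm ((B ^^ n) y)" for n
  proof (induction n)
    case (Suc n)
    have "(s + c) * ((s + c) ^ n * norm y) \<le> (s + c) * norm ((B ^^ n) y)"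
      using Suc tc sc by (intro mult_left_mono) auto
    also have "\<dots> \<le> norm (B ((B ^^ n) y))" using Suc Blo by blast
    finally show ?case using Suc BN' by (simp add: mult.assoc)
  qed (simp add: yN)
  \<comment> \<open>\<open>N\<close> reduces \<open>B\<close>, so B^n y is the part of B^n x
    orthogonal to \<open>N\<close>. The fast growth of the former is thus bounded by the slow growth
    of the latter, which forces y = 0.\<close>
  have pow: "(B ^^ n) y = (B ^^ n) x - prj N ((B ^^ n) x)" for n
  proof (induction n)
    case (Suc n)
    then show ?case
      using N.prj_commute[OF selfadj_linear[OF B] BN BN'] by (simp add: linear_diff[OF selfadj_linear[OF B]])
  qed (simp add: y_def)
  have "norm (z - prj N z) \<le> norm z" for z
    by (rule power2_le_imp_le) (simp_all add: N.norm_prj_split[of z])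
  then have bound: "(s + c) ^ n * norm y \<le> (t + c) ^ n * norm x" for n
    using up[of n] lo[of n] pow[of n] by (metis order_trans)
  have "y = 0"
  proof (rule ccontr)
    assume "y \<noteq> 0"
    have "1 < (s + c) / (t + c)" using tc sc by simp
    from real_arch_pow[OF this] obtain n where n: "norm x / norm y < ((s + c) / (t + c)) ^ n" by blast
    have "norm x * (t + c) ^ n < (s + c) ^ n * norm y"
      using n \<open>y \<noteq> 0\<close> tc by (simp add: power_divide field_simps)
    then show False using bound[of n] by (simp add: mult.commute)
  qed
  then have "prj N x = x" by (simp add: y_def)
  then show "x \<in> N" by (simp only: N.prj_fix_iff)
qed

text \<open>The comparison needs a gap between the levels and yields F t \<subseteq> G s only for t
  < s; right-continuity of \<open>G\<close> closes the gap.\<close>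

lemma represents_unique:
  fixes A :: "'a::{real_inner, complete_space} \<Rightarrow> 'a"
  assumes A: "selfadj A" and F: "resolution J F" "represents A F" and G: "resolution J G" "represents A G"
  shows "F = G"
proof -
  have *: "F t \<subseteq> G t" if F: "resolution J F" "represents A F" and G: "resolution J G" "represents A G" for F G :: "real \<Rightarrow> 'a set" and t
  proof
    fix x assume x: "x \<in> F t"
    have "F t \<subseteq> G s" if "t < s" for s
    proof (rule spectral_compare[OF A _ _ _ _ _ _ that])
      show "subspace (F t)" using resolution_csub[OF F(1)] by (simp add: csub_def)
      show "closed_subspace (G s)" by (rule resolution_closed_subspace[OF G(1)])
    qed (use F G in \<open>auto simp: represents_def\<close>)
    then show "x \<in> G t" using resolution_right[OF G(1)] x by blast
  qed
  show ?thesis using *[OF F G] *[OF G F] by (intro ext subset_antisym)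
qed

lemma is_bsa_selfadj: "is_bsa J A \<Longrightarrow> selfadj A"
  by (simp add: is_bsa_def is_bop_def selfadj_def)

lemma is_bsa_iff: "is_bsa J A \<longleftrightarrow> selfadj A \<and> (\<forall>x. A (J x) = J (A x))"
  by (auto simp: is_bsa_def is_bop_def selfadj_def)

theorem spectral_theorem:
  fixes A :: "'a::{real_inner, complete_space} \<Rightarrow> 'a"
  assumes J: "complex_structure J" and bsa: "is_bsa J A"
  obtains F where "resolution J F" "represents A F"
proof -
  have A: "selfadj A" and AJ: "\<And>x. A (J x) = J (A x)" using bsa by (auto simp: is_bsa_iff)
  have "\<exists>P. closed_subspace P \<and> (\<forall>x\<in>P. A x \<in> P \<and> inner x (A x) \<le> t * inner x x) \<and>
      (\<forall>x\<in>P\<^sup>\<bottom>. t * inner x x \<le> inner x (A x))" for t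
  proof -
    obtain K where K: "closed_subspace K" "\<And>x. x \<in> K \<Longrightarrow> A x - t *\<^sub>R x \<in> K"
      "\<And>x. x \<in> K \<Longrightarrow> inner x (A x - t *\<^sub>R x) \<le> 0" "\<And>x. x \<in> K\<^sup>\<bottom> \<Longrightarrow> 0 \<le> inner x (A x - t *\<^sub>R x)"
      by (rule sign_split[OF selfadj_diff[OF A selfadj_scaleR]]) (rule that)
    have "A x \<in> K" if "x \<in> K" for x
      using subspace_add[OF closed_subspace.subspace[OF K(1)] K(2)[OF that]
          subspace_scale[OF closed_subspace.subspace[OF K(1)] that, of t]] by simp
    then show ?thesis using K by (intro exI[of _ K]) (auto simp: inner_diff)
  qed
  then obtain P where P: "\<And>t. closed_subspace (P t)" "\<And>t x. x \<in> P t \<Longrightarrow> A x \<in> P t"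
    "\<And>t x. x \<in> P t \<Longrightarrow> inner x (A x) \<le> t * inner x x"
    "\<And>t x. x \<in> (P t)\<^sup>\<bottom> \<Longrightarrow> t * inner x x \<le> inner x (A x)"
    by metis
  note Psub = closed_subspace.subspace[OF P(1)]
  have PP: "P t \<subseteq> P s" if "t < s" for s t
    by (rule spectral_compare[OF A Psub P(2,3) P(1) P(2,4) that])
  \<comment> \<open>The splitting at level t leaves a choice on the eigenspace for t, so
    \<open>P\<close> is compared only across a strict gap of levels. Intersecting over the higher
    levels removes the choice and gives right-continuity.\<close>
  define F where "F = (\<lambda>t. \<Inter>s\<in>{t<..}. P s)"
  have PF: "P t \<subseteq> F t" for t using PP by (auto simp: F_def)
  \<comment> \<open>The choice of \<open>P t\<close> need not respect \<open>J\<close>. But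
    \<open>J\<close> commutes with \<open>A\<close> and preserves inner products, so the image of
    \<open>P t\<close> obeys the same upper bound and lies in every later \<open>P s\<close>; the
    intersection \<open>F\<close> absorbs the gap.\<close>
  have JP: "J x \<in> P s" if "x \<in> P t" "t < s" for x s t
  proof -
    have Jl: "linear J" and Ji: "\<And>x y. inner (J x) (J y) = inner x y" using J by (auto simp: complex_structure_def)
    have "J ` P t \<subseteq> P s"
    proof (rule spectral_compare[OF A linear_subspace_image[OF Jl Psub] _ _ P(1,2,4) that(2)])
      show "A y \<in> J ` P t" if "y \<in> J ` P t" for y using that P(2) by (auto simp: AJ)
      show "inner y (A y) \<le> t * inner y y" if "y \<in> J ` P t" for y using that P(3) by (auto simp: AJ Ji)
    qed
    then show ?thesis using that(1) by blast
  qed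
  obtain K where K: "K > 0" "\<And>x. norm (A x) \<le> K * norm x" "\<And>x. \<bar>inner x (A x)\<bar> \<le> K * inner x x"
    by (rule selfadj_bound[OF A]) (rule that)
  have rep: "represents A F"
    unfolding represents_def
  proof (intro allI conjI ballI)
    fix t x
    show "A x \<in> F t" if "x \<in> F t" using that P(2) by (auto simp: F_def)
    show "inner x (A x) \<le> t * inner x x" if "x \<in> F t"
    proof (rule tendsto_lowerbound[where F="at_right t" and f="\<lambda>s. s * inner x x"])
      show "((\<lambda>s. s * inner x x) \<longlongrightarrow> t * inner x x) (at_right t)" by (intro tendsto_intros)
      show "\<forall>\<^sub>F s in at_right t. inner x (A x) \<le> s * inner x x"
        using that P(3) by (auto simp: F_def eventually_at_right_less eventually_at intro!: exI[of _ 1])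
    qed simp
    show "t * inner x x \<le> inner x (A x)" if "x \<in> (F t)\<^sup>\<bottom>" using that orth_antimono[OF PF] P(4) by blast
  qed
  have Fcs: "closed_subspace (F t)" for t
    unfolding F_def using closed_subspace.closed[OF P(1)] Psub
    by unfold_locales (auto intro!: subspace_Inter)
  have res: "resolution J F"
    unfolding resolution_def
  proof (intro conjI allI impI)
    show "csub J (F t)" for t
    proof -
      have "J x \<in> F t" if "x \<in> F t" for x
        unfolding F_def
      proof
        fix s assume "s \<in> {t<..}"
        then obtain u where "t < u" "u < s" using dense by auto
        then show "J x \<in> P s" using that by (auto simp: F_def intro: JP)
      qed
      then show ?thesis using Fcs[of t] by (auto simp: csub_def closed_subspace_def)
    qed
    show "F s \<subseteq> F t" if "s \<le> t" for s t using that by (auto simp: F_def)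
    show "(\<Inter>s\<in>{t<..}. F s) \<subseteq> F t" for t
    proof
      fix x assume x: "x \<in> (\<Inter>s\<in>{t<..}. F s)"
      have "x \<in> P u" if "t < u" for u
      proof -
        obtain s where "t < s" "s < u" using dense \<open>t < u\<close> by auto
        then show ?thesis using x by (auto simp: F_def)
      qed
      then show "x \<in> F t" by (auto simp: F_def)
    qed
    show "\<exists>a b. (\<forall>t<a. F t = {0}) \<and> (\<forall>t\<ge>b. F t = UNIV)"
    \<comment> \<open>The argument for the whole space needs K < t strictly, while the upper bound
      is attained in the definition; hence K + 1.\<close>
    proof (rule exI[of _ "- K"], rule exI[of _ "K + 1"], intro conjI allI impI)
      fix t assume t: "t < - K"
      have "x = 0" if "x \<in> F t" for x
      proof (rule ccontr)
        assume "x \<noteq> 0"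
        then have "t * inner x x < - K * inner x x" using t by (intro mult_strict_right_mono) auto
        moreover have "inner x (A x) \<le> t * inner x x" using rep that by (auto simp: represents_def)
        ultimately show False using K(3)[of x] by linarith
      qed
      then show "F t = {0}" using subspace_0[OF closed_subspace.subspace[OF Fcs]] by blast
    next
      fix t assume t: "K + 1 \<le> t"
      have "x = 0" if "x \<in> (F t)\<^sup>\<bottom>" for x
      proof (rule ccontr)
        assume "x \<noteq> 0"
        then have "K * inner x x < t * inner x x" using t by (intro mult_strict_right_mono) auto
        moreover have "t * inner x x \<le> inner x (A x)" using rep that by (auto simp: represents_def)
        ultimately show False using K(3)[of x] by linarith
      qed
      then have "(F t)\<^sup>\<bottom> = {0}" using subspace_0[OF subspace_orthogonal_comp] by blast
      then show "F t = UNIV" using closed_subspace.eq_UNIV_iff[OF Fcs] by blast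
    qed
  qed
  show ?thesis by (rule that[OF res rep])
qed

section \<open>Operators from resolutions by dyadic Stieltjes sums\<close>

lemma sum_lessThan_double: "(\<Sum>k<2 * N. f k) = (\<Sum>k<N. f (2 * k) + f (Suc (2 * k)))"
  for f :: "nat \<Rightarrow> 'a::comm_monoid_add"
  by (induction N) (simp_all add: add.assoc)

lemma resolution_prj_diff_nonneg:
  fixes F :: "real \<Rightarrow> 'a::{real_inner, complete_space} set"
  assumes F: "resolution J F" and "s \<le> t"
  shows "0 \<le> inner x (prj (F t) x - prj (F s) x)"
proof -
  interpret S: closed_subspace "F s" by (rule resolution_closed_subspace[OF F])
  interpret T: closed_subspace "F t" by (rule resolution_closed_subspace[OF F])
  have "norm (prj (F s) x) \<le> norm (prj (F t) x)"
    using S.norm_prj[of "prj (F t) x"]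
      prj_prj_subset(1)[OF S.closed_subspace_axioms T.closed_subspace_axioms resolution_mono[OF assms]] by simp
  then have "(norm (prj (F s) x))\<^sup>2 \<le> (norm (prj (F t) x))\<^sup>2" by (intro power_mono) auto
  then show ?thesis by (simp add: inner_diff S.inner_prj_self T.inner_prj_self)
qed

text \<open>Lower Stieltjes sums over dyadic subdivisions of [a, b] increase under refinement.
  Measuring the levels from \<open>a\<close> keeps the sums between 0 and b - a, so they converge
  strongly, to A - a.\<close>

theorem resolution_operator:
  fixes F :: "real \<Rightarrow> 'a::{real_inner, complete_space} set"
  assumes J: "complex_structure J" and F: "resolution J F"
  obtains A where "is_bsa J A" "represents A F"
proof -
  obtain a b where ab: "a < b" "\<And>t. t \<le> a \<Longrightarrow> F t = {0}" "\<And>t. b \<le> t \<Longrightarrow> F t = UNIV"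
    by (rule resolution_bounds[OF F]) (rule that)
  note cs = resolution_closed_subspace[OF F]
  define E where "E = (\<lambda>t. prj (F t))"
  define h where "h n = (b - a) / 2 ^ n" for n :: nat
  define s where "s n k = a + real k * h n" for n k
  define T where "T n x = (\<Sum>k<2^n. (real k * h n) *\<^sub>R (E (s n (Suc k)) x - E (s n k) x))" for n x
  define q where "q n k x = inner x (E (s n (Suc k)) x - E (s n k) x)" for n k x
  have h0: "h n > 0" for n using ab(1) by (simp add: h_def)
  have hSuc: "h n = 2 * h (Suc n)" for n by (simp add: h_def field_simps)
  have ss: "s n k \<le> s n (Suc k)" for n k using h0[of n] by (simp add: s_def algebra_simps)
  have q0: "0 \<le> q n k x" for n k x
    unfolding q_def E_def by (rule resolution_prj_diff_nonneg[OF F ss])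
  have Ea: "E a x = 0" and Eb: "E b x = x" for x
    using closed_subspace.prj_in[OF cs, of a x] closed_subspace.prj_id[OF cs, of x b] ab by (auto simp: E_def)
  have qsum: "(\<Sum>k<2^n. q n k x) = inner x x" for n x
  proof -
    have "(\<Sum>k<2^n. q n k x) = inner x (E (s n (2^n)) x - E (s n 0) x)"
      unfolding q_def inner_sum_right[symmetric] using sum_lessThan_telescope[of "\<lambda>k. E (s n k) x" "2^n"] by simp
    moreover have "s n (2^n) = b" "s n 0 = a" by (auto simp: s_def h_def)
    ultimately show ?thesis by (simp add: Ea Eb)
  qed
  have inner_T: "inner x (T n x) = (\<Sum>k<2^n. (real k * h n) * q n k x)" for n x
    by (simp add: T_def q_def inner_sum_right)
  have T: "selfadj (T n)" for n
    unfolding T_def E_def by (intro selfadj_sum selfadj_scale selfadj_diff selfadj_prj cs)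
  have Tpos: "0 \<le> inner x (T n x)" for n x
    unfolding inner_T by (intro sum_nonneg mult_nonneg_nonneg q0 less_imp_le[OF h0]) simp
  have Tle: "inner x (T n x) \<le> (b - a) * inner x x" for n x
    unfolding inner_T qsum[of n x, symmetric] sum_distrib_left
  proof (intro sum_mono mult_right_mono q0)
    fix k assume "k \<in> {..<(2::nat)^n}"
    then have "real k \<le> 2 ^ n" by (simp add: less_imp_le)
    from mult_left_mono[OF this, of "b - a"] show "real k * h n \<le> b - a"
      using ab(1) by (simp add: h_def field_simps)
  qed
  have Tinc: "inner x (T n x) \<le> inner x (T (Suc n) x)" for n x
  proof -
    have s2: "s (Suc n) (2 * k) = s n k" "s (Suc n) (Suc (Suc (2 * k))) = s n (Suc k)" for k
      by (simp_all add: s_def hSuc[of n] algebra_simps)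
    \<comment> \<open>Halving the mesh splits every increment in two; the left half keeps its weight
      and the right half gains one new mesh width.\<close>
    have "inner x (T n x) = (\<Sum>k<2^n. real k * h n * (q (Suc n) (2 * k) x + q (Suc n) (Suc (2 * k)) x))"
      unfolding inner_T q_def s2 by (simp add: inner_diff)
    also have "\<dots> \<le> (\<Sum>k<2^n. (real (2 * k) * h (Suc n)) * q (Suc n) (2 * k) x
        + (real (Suc (2 * k)) * h (Suc n)) * q (Suc n) (Suc (2 * k)) x)"
    proof (intro sum_mono)
      fix k
      have "0 \<le> h (Suc n) * q (Suc n) (Suc (2 * k)) x"
        by (intro mult_nonneg_nonneg q0 less_imp_le[OF h0])
      then show "real k * h n * (q (Suc n) (2 * k) x + q (Suc n) (Suc (2 * k)) x)
        \<le> (real (2 * k) * h (Suc n)) * q (Suc n) (2 * k) x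
        + (real (Suc (2 * k)) * h (Suc n)) * q (Suc n) (Suc (2 * k)) x"
        by (simp add: hSuc[of n] algebra_simps)
    qed
    also have "\<dots> = inner x (T (Suc n) x)"
      unfolding inner_T by (simp only: power_Suc sum_lessThan_double)
    finally show ?thesis .
  qed
  have ba: "0 < b - a" using ab(1) by simp
  obtain D where D: "selfadj D" "\<And>x. (\<lambda>n. T n x) \<longlonglongrightarrow> D x"
    by (rule selfadj_incseq_converges[of T "b - a", OF T Tpos Tle ba Tinc]) (rule that)
  have Dq: "(\<lambda>n. inner x (T n x)) \<longlonglongrightarrow> inner x (D x)" for x
    by (intro tendsto_inner tendsto_const D)
  define A where "A = (\<lambda>x. a *\<^sub>R x + D x)"
  have linJ: "linear J" using J by (simp add: complex_structure_def)
  have blJ: "bounded_linear J"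
  proof (rule bounded_linear_intro[where K=1])
    have "inner (J x) (J x) = inner x x" for x using J by (simp add: complex_structure_def)
    then show "norm (J x) \<le> norm x * 1" for x by (simp add: norm_eq_sqrt_inner)
  qed (simp_all add: linear_add[OF linJ] linear_scale[OF linJ])
  have TJ: "T n (J x) = J (T n x)" for n x
    unfolding T_def E_def linear_sum[OF linJ] linear_scale[OF linJ] linear_diff[OF linJ]
      prj_J_commute[OF J resolution_csub[OF F]] ..
  have "is_bsa J A"
    unfolding is_bsa_iff
  proof (intro conjI allI)
    show "selfadj A" unfolding A_def by (intro selfadj_add selfadj_scaleR D)
    fix x
    have "(\<lambda>n. T n (J x)) \<longlonglongrightarrow> J (D x)" unfolding TJ by (rule bounded_linear.tendsto[OF blJ D(2)])
    then have "D (J x) = J (D x)" using LIMSEQ_unique D(2) by blast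
    then show "A (J x) = J (A x)" by (simp add: A_def linear_add[OF linJ] linear_scale[OF linJ])
  qed
  moreover have "represents A F"
    unfolding represents_def
  proof (intro allI conjI ballI)
    fix t x
    interpret Ft: closed_subspace "F t" by (rule cs)
    show "A x \<in> F t" if x: "x \<in> F t"
    proof -
      have Ex: "E u x \<in> F t" for u
        using closed_subspace.prj_in[OF cs, of u x] closed_subspace.prj_id[OF cs, of x u] x
          resolution_mono[OF F, of u t] resolution_mono[OF F, of t u] unfolding E_def by (cases "u \<le> t") auto
      have "T n x \<in> F t" for n
        unfolding T_def by (intro subspace_sum subspace_scale subspace_diff Ft.subspace Ex)
      then have "D x \<in> F t" using closed_sequentially[OF Ft.closed _ D(2)] by blast
      then show ?thesis unfolding A_def by (intro subspace_add subspace_scale Ft.subspace x)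
    qed
    show "inner x (A x) \<le> t * inner x x" if x: "x \<in> F t"
    proof -
      \<comment> \<open>Cells starting at t or later contribute nothing, since \<open>x\<close>
        already belongs to the subspaces at both ends; all other cells have their left endpoint
        below t.\<close>
      have "inner x (T n x) \<le> (t - a) * inner x x" for n
        unfolding inner_T qsum[of n x, symmetric] sum_distrib_left
      proof (intro sum_mono)
        fix k
        show "real k * h n * q n k x \<le> (t - a) * q n k x"
        proof (cases "s n k < t")
          case True
          then show ?thesis by (intro mult_right_mono q0) (simp add: s_def)
        next
          case False
          then have "F t \<subseteq> F (s n k)" "F t \<subseteq> F (s n (Suc k))"
            using resolution_mono[OF F, of t] ss[of n k] by auto
          with x have "x \<in> F (s n k)" "x \<in> F (s n (Suc k))" by blast+
          then have "q n k x = 0" by (simp add: q_def E_def closed_subspace.prj_id[OF cs])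
          then show ?thesis by simp
        qed
      qed
      then have "inner x (D x) \<le> (t - a) * inner x x" by (intro LIMSEQ_le_const2[OF Dq]) auto
      then show ?thesis by (simp add: A_def inner_add algebra_simps)
    qed
    show "t * inner x x \<le> inner x (A x)" if x: "x \<in> (F t)\<^sup>\<bottom>"
    proof -
      \<comment> \<open>Cells ending at or below t vanish on the complement. For the others only the
        right endpoint is known to exceed t, and passing to the left endpoint loses the mesh width
        \<open>h n\<close>.\<close>
      have le: "(t - a - h n) * inner x x \<le> inner x (T n x)" for n
        unfolding inner_T qsum[of n x, symmetric] sum_distrib_left
      proof (intro sum_mono)
        fix k
        show "(t - a - h n) * q n k x \<le> real k * h n * q n k x"
        proof (cases "t < s n (Suc k)")
          case True
          then show ?thesis by (intro mult_right_mono q0) (simp add: s_def algebra_simps)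
        next
          case False
          then have "F (s n k) \<subseteq> F t" "F (s n (Suc k)) \<subseteq> F t"
            using resolution_mono[OF F, of _ t] ss[of n k] by auto
          then have "x \<in> (F (s n k))\<^sup>\<bottom>" "x \<in> (F (s n (Suc k)))\<^sup>\<bottom>"
            using x orth_antimono by blast+
          then have "q n k x = 0" by (simp add: q_def E_def closed_subspace.prj_0[OF cs])
          then show ?thesis by simp
        qed
      qed
      have "h \<longlonglongrightarrow> 0"
        unfolding h_def by (rule LIMSEQ_divide_realpow_zero) simp
      then have "(\<lambda>n. (t - a - h n) * inner x x) \<longlonglongrightarrow> (t - a - 0) * inner x x"
        by (intro tendsto_intros)
      then have "(t - a - 0) * inner x x \<le> inner x (D x)"
        by (rule LIMSEQ_le[OF _ Dq]) (use le in auto)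
      then show ?thesis by (simp add: A_def inner_add algebra_simps)
    qed
  qed
  ultimately show ?thesis by (rule that)
qed

section \<open>Spectral families\<close>

text \<open>On a subdivision into n+1 equal parts the increments of \<open>f\<close> telescope, so
  the difference of the end values of \<open>d\<close> is at most (b - a)(f b - f a)/(n+1). Neither
  function has to be differentiable or continuous.\<close>

lemma eq_of_small_increments:
  fixes d f :: "real \<Rightarrow> real"
  assumes "a \<le> b" and inc: "\<And>s t. a \<le> s \<Longrightarrow> s \<le> t \<Longrightarrow> t \<le> b \<Longrightarrow> \<bar>d t - d s\<bar> \<le> (t - s) * (f t - f s)"
  shows "d a = d b"
proof -
  have *: "\<bar>d b - d a\<bar> \<le> (b - a) * (f b - f a) * inverse (real (Suc n))" for n
  proof -
    define h where "h = (b - a) / real (Suc n)"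
    define s where "s k = a + real k * h" for k
    have h0: "0 \<le> h" using \<open>a \<le> b\<close> by (simp add: h_def)
    have s0: "s 0 = a" and sn: "s (Suc n) = b" by (simp_all add: s_def h_def)
    have sle: "s k \<le> b" if "k \<le> Suc n" for k
    proof -
      have "s k \<le> s (Suc n)" using that h0 by (auto simp: s_def intro!: mult_right_mono)
      then show ?thesis by (simp add: sn)
    qed
    have "\<bar>d b - d a\<bar> = \<bar>\<Sum>k<Suc n. d (s (Suc k)) - d (s k)\<bar>"
      by (simp only: sum_lessThan_telescope[of "\<lambda>k. d (s k)"] s0 sn)
    also have "\<dots> \<le> (\<Sum>k<Suc n. \<bar>d (s (Suc k)) - d (s k)\<bar>)" by (rule sum_abs)
    also have "\<dots> \<le> (\<Sum>k<Suc n. h * (f (s (Suc k)) - f (s k)))"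
    proof (rule sum_mono)
      fix k assume "k \<in> {..<Suc n}"
      then have "s (Suc k) \<le> b" by (intro sle) auto
      moreover have "a \<le> s k" "s k \<le> s (Suc k)" using h0 by (auto simp: s_def algebra_simps)
      moreover have "s (Suc k) - s k = h" by (simp add: s_def algebra_simps)
      ultimately show "\<bar>d (s (Suc k)) - d (s k)\<bar> \<le> h * (f (s (Suc k)) - f (s k))"
        using inc[of "s k" "s (Suc k)"] by simp
    qed
    also have "\<dots> = h * (f b - f a)"
      by (simp only: sum_distrib_left[symmetric] sum_lessThan_telescope[of "\<lambda>k. f (s k)"] s0 sn)
    finally show ?thesis by (simp add: h_def divide_inverse mult_ac)
  qed
  have "(\<lambda>n. (b - a) * (f b - f a) * inverse (real (Suc n))) \<longlonglongrightarrow> (b - a) * (f b - f a) * 0"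
    by (intro tendsto_mult tendsto_const LIMSEQ_inverse_real_of_nat)
  then have "\<bar>d b - d a\<bar> \<le> 0" using * by (intro LIMSEQ_le_const[where X="\<lambda>n. (b - a) * (f b - f a) * inverse (real (Suc n))"]) auto
  then show ?thesis by simp
qed

lemma resolution_prj_norm_diff:
  fixes F :: "real \<Rightarrow> 'a::{real_inner, complete_space} set"
  assumes F: "resolution J F" and "s \<le> t"
  shows "(norm (prj (F t) x - prj (F s) x))\<^sup>2 = inner x (prj (F t) x) - inner x (prj (F s) x)"
proof -
  interpret S: closed_subspace "F s" by (rule resolution_closed_subspace[OF F])
  interpret T: closed_subspace "F t" by (rule resolution_closed_subspace[OF F])
  have "inner (prj (F t) x) (prj (F s) x) = inner x (prj (F s) x)"
    using prj_prj_subset(2)[OF S.closed_subspace_axioms T.closed_subspace_axioms resolution_mono[OF assms]]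
    by (simp add: T.inner_prj)
  then show ?thesis
    by (simp add: power2_norm_eq_inner inner_diff inner_commute) (simp add: inner_commute flip: power2_norm_eq_inner S.inner_prj_self T.inner_prj_self)
qed

text \<open>Along levels decreasing to t the projections of \<open>x\<close> are Cauchy, because
  squared norms of their differences are increments of a bounded monotone function. The limit lies
  in every later \<open>F s\<close>, hence in \<open>F t\<close>, and the error is orthogonal to
  \<open>F t\<close>.\<close>

lemma resolution_right_continuous:
  fixes F :: "real \<Rightarrow> 'a::{real_inner, complete_space} set"
  assumes F: "resolution J F"
  shows "((\<lambda>s. prj (F s) x) \<longlongrightarrow> prj (F t) x) (at_right t)"
proof -
  note cs = resolution_closed_subspace[OF F]
  define u where "u n = t + inverse (real (Suc n))" for n
  define f where "f s = inner x (prj (F s) x)" for s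
  have fmono: "f s \<le> f r" if "s \<le> r" for s r
    using resolution_prj_diff_nonneg[OF F that, of x] by (simp add: f_def inner_diff)
  have nd: "(norm (prj (F r) x - prj (F s) x))\<^sup>2 = f r - f s" if "s \<le> r" for s r
    unfolding f_def by (rule resolution_prj_norm_diff[OF F that])
  have udec: "u n \<le> u m" if "m \<le> n" for m n using that by (simp add: u_def field_simps)
  have ut: "t < u n" for n by (simp add: u_def)
  have "decseq (\<lambda>n. f (u n))" using fmono udec by (auto simp: decseq_def)
  moreover have "0 \<le> f s" for s
    using closed_subspace.inner_prj_self[OF cs] by (simp add: f_def)
  ultimately obtain l where "(\<lambda>n. f (u n)) \<longlonglongrightarrow> l" using decseq_convergent by blast
  then have Cf: "Cauchy (\<lambda>n. f (u n))" by (rule LIMSEQ_imp_Cauchy)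
  have "Cauchy (\<lambda>n. prj (F (u n)) x)"
  proof (rule CauchyI)
    fix e :: real assume e: "e > 0"
    then obtain N where N: "\<And>m n. m \<ge> N \<Longrightarrow> n \<ge> N \<Longrightarrow> norm (f (u m) - f (u n)) < e\<^sup>2"
      using CauchyD[OF Cf, of "e\<^sup>2"] by auto
    have *: "norm (prj (F (u m)) x - prj (F (u n)) x) < e" if "m \<ge> N" "n \<ge> N" "m \<le> n" for m n
    proof -
      have "(norm (prj (F (u m)) x - prj (F (u n)) x))\<^sup>2 < e\<^sup>2"
        using N[OF that(1,2)] nd[OF udec[OF that(3)]] by simp
      then show ?thesis using e by (simp add: power2_less_imp_less)
    qed
    have "norm (prj (F (u m)) x - prj (F (u n)) x) < e" if "m \<ge> N" "n \<ge> N" for m n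
      using *[of m n] *[of n m] that by (cases "m \<le> n") (auto simp: norm_minus_commute)
    then show "\<exists>N. \<forall>m\<ge>N. \<forall>n\<ge>N. norm (prj (F (u m)) x - prj (F (u n)) x) < e" by blast
  qed
  then obtain y where y: "(\<lambda>n. prj (F (u n)) x) \<longlonglongrightarrow> y" using Cauchy_convergent convergent_def by blast
  have "y \<in> F s" if ts: "t < s" for s
  proof (rule Lim_in_closed_set[OF closed_subspace.closed[OF cs] _ _ y])
    obtain N where N: "inverse (real (Suc N)) < s - t" using reals_Archimedean[of "s - t"] ts by auto
    show "\<forall>\<^sub>F n in sequentially. prj (F (u n)) x \<in> F s"
    proof (rule eventually_sequentiallyI[of N])
      fix n assume "N \<le> n"
      then have "u n \<le> u N" by (rule udec)
      then have "u n \<le> s" using N unfolding u_def[of N] by simp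
      then show "prj (F (u n)) x \<in> F s"
        using closed_subspace.prj_in[OF cs] resolution_mono[OF F] by blast
    qed
  qed simp
  then have yt: "y \<in> F t" by (rule resolution_right[OF F])
  have "x - y \<in> (F t)\<^sup>\<bottom>"
  proof (rule closed_sequentially[OF closed_orth])
    show "x - prj (F (u n)) x \<in> (F t)\<^sup>\<bottom>" for n
      using closed_subspace.prj_diff[OF cs] orth_antimono[OF resolution_mono[OF F less_imp_le[OF ut]]] by blast
    show "(\<lambda>n. x - prj (F (u n)) x) \<longlonglongrightarrow> x - y" by (intro tendsto_intros y)
  qed
  then have yE: "prj (F t) x = y" using yt by (intro closed_subspace.prj_eqI cs)
  show ?thesis
  proof (rule tendstoI)
    fix e :: real assume "e > 0"
    from LIMSEQ_D[OF y this] obtain N where N: "norm (prj (F (u N)) x - prj (F t) x) < e"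
      unfolding yE by blast
    have "dist (prj (F s) x) (prj (F t) x) < e" if "t < s" "s < u N" for s
    proof -
      have "(norm (prj (F s) x - prj (F t) x))\<^sup>2 \<le> (norm (prj (F (u N)) x - prj (F t) x))\<^sup>2"
        using that fmono[of s "u N"] ut[of N] by (simp add: nd)
      then have "norm (prj (F s) x - prj (F t) x) \<le> norm (prj (F (u N)) x - prj (F t) x)"
        by (rule power2_le_imp_le) simp
      then show ?thesis using N by (simp add: dist_norm)
    qed
    then show "\<forall>\<^sub>F s in at_right t. dist (prj (F s) x) (prj (F t) x) < e"
      unfolding eventually_at_right_field using ut[of N] by blast
  qed
qed

text \<open>Both \<open>t \<mapsto> \<langle>E\<^sub>t x, A E\<^sub>t x\<rangle>\<close> and the truncated Stieltjes integral have increments between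
  \<open>s (f t - f s)\<close> and \<open>t (f t - f s)\<close>, where \<open>f t = \<langle>x, E\<^sub>t x\<rangle>\<close>.\<close>

theorem represents_integral:
  fixes F :: "real \<Rightarrow> 'a::{real_inner, complete_space} set"
  assumes A: "selfadj A" and F: "resolution J F" and rep: "represents A F"
  shows "integrable (interval_measure (\<lambda>t. inner x (prj (F t) x))) (\<lambda>t. t)"
    and "inner x (A x) = integral\<^sup>L (interval_measure (\<lambda>t. inner x (prj (F t) x))) (\<lambda>t. t)"
proof -
  note cs = resolution_closed_subspace[OF F]
  obtain a b where ab: "a < b" "\<And>t. t \<le> a \<Longrightarrow> F t = {0}" "\<And>t. b \<le> t \<Longrightarrow> F t = UNIV"
    by (rule resolution_bounds[OF F]) (rule that)
  define f where "f t = inner x (prj (F t) x)" for t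
  define M where "M = interval_measure f"
  have fmono: "f s \<le> f t" if "s \<le> t" for s t
    using resolution_prj_diff_nonneg[OF F that, of x] by (simp add: f_def inner_diff)
  have frc: "continuous (at_right t) f" for t
    unfolding f_def continuous_within by (intro tendsto_intros resolution_right_continuous[OF F])
  have fa: "f t = 0" if "t \<le> a" for t
    using closed_subspace.prj_in[OF cs, of t x] ab(2)[OF that] by (simp add: f_def)
  have fb: "f t = inner x x" if "b \<le> t" for t
    using closed_subspace.prj_id[OF cs, of x t] ab(3)[OF that] by (simp add: f_def)
  have emea: "emeasure M {s<..t} = ennreal (f t - f s)" if "s \<le> t" for s t
    unfolding M_def by (rule emeasure_interval_measure_Ioc[OF that fmono frc])
  have mea: "measure M {s<..t} = f t - f s" if "s \<le> t" for s t
    unfolding M_def by (rule measure_interval_measure_Ioc[OF that fmono frc])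
  have setsM: "sets M = sets borel" by (simp add: M_def)
  \<comment> \<open>The measure lives on a bounded interval, which makes the unbounded integrand
    integrable. The interval is open at \<open>a\<close>, where \<open>F\<close> already vanishes,
    and closed at \<open>b\<close>, where a jump may occur.\<close>
  have AEM: "AE t in M. t \<in> {a<..b}"
  proof -
    have "{a - real (Suc n)<..a} \<in> null_sets M" "{b<..b + real (Suc n)} \<in> null_sets M" for n
      using emea[of "a - real (Suc n)" a] emea[of b "b + real (Suc n)"] fa fb
      by (auto simp: null_sets_def setsM)
    then have n: "(\<Union>n. {a - real (Suc n)<..a}) \<in> null_sets M" "(\<Union>n. {b<..b + real (Suc n)}) \<in> null_sets M"
      by (auto intro!: null_sets_UN)
    have sub: "{..a} \<subseteq> (\<Union>n. {a - real (Suc n)<..a})" "{b<..} \<subseteq> (\<Union>n. {b<..b + real (Suc n)})"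
    proof -
      show "{..a} \<subseteq> (\<Union>n. {a - real (Suc n)<..a})"
      proof
        fix t assume t: "t \<in> {..a}"
        obtain n where "a - t < real n" using reals_Archimedean2 by blast
        then show "t \<in> (\<Union>n. {a - real (Suc n)<..a})" using t by (auto intro!: exI[of _ n])
      qed
      show "{b<..} \<subseteq> (\<Union>n. {b<..b + real (Suc n)})"
      proof
        fix t assume t: "t \<in> {b<..}"
        obtain n where "t - b < real n" using reals_Archimedean2 by blast
        then show "t \<in> (\<Union>n. {b<..b + real (Suc n)})" using t by (auto intro!: exI[of _ n])
      qed
    qed
    have "{..a} \<in> null_sets M" "{b<..} \<in> null_sets M"
      using null_sets_subset[OF n(1) _ sub(1)] null_sets_subset[OF n(2) _ sub(2)] by (simp_all add: setsM)
    then have "AE t in M. t \<notin> {..a}" "AE t in M. t \<notin> {b<..}" by (blast intro: AE_not_in)+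
    then show ?thesis by eventually_elim auto
  qed
  have ifin: "integrable M (\<lambda>u. indicator {s<..t} u * c)" if "s \<le> t" for s t c :: real
    using emea[OF that] by (intro integrable_mult_left integrable_real_indicator) (auto simp: setsM)
  have iind: "integrable M (\<lambda>u. indicator {s<..t} u * u)" if "s \<le> t" for s t :: real
  proof (rule Bochner_Integration.integrable_bound[OF ifin[OF that, of "max \<bar>s\<bar> \<bar>t\<bar>"]])
    show "(\<lambda>u. indicator {s<..t} u * u) \<in> borel_measurable M"
      by (simp add: M_def)
    show "AE u in M. norm (indicator {s<..t} u * u) \<le> norm (indicator {s<..t} u * max \<bar>s\<bar> \<bar>t\<bar>)"
      by (auto simp: indicator_def)
  qed
  have Meq: "AE u in M. indicator {a<..b} u * u = u"
    using AEM by eventually_elim auto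
  have "integrable M (\<lambda>u. u)"
    using iind[of a b] ab(1) integrable_cong_AE[OF _ _ Meq] by (simp add: M_def)
  then show "integrable (interval_measure (\<lambda>t. inner x (prj (F t) x))) (\<lambda>t. t)"
    by (simp add: M_def f_def[abs_def])
  define g where "g t = (\<integral>u. indicator {a<..t} u * u \<partial>M)" for t
  define k where "k t = inner (prj (F t) x) (A (prj (F t) x))" for t
  have gd: "s * (f t - f s) \<le> g t - g s \<and> g t - g s \<le> t * (f t - f s)" if "a \<le> s" "s \<le> t" for s t
  proof -
    have "g t - g s = (\<integral>u. indicator {a<..t} u * u - indicator {a<..s} u * u \<partial>M)"
      unfolding g_def using that by (intro Bochner_Integration.integral_diff[symmetric] iind) auto
    also have "\<dots> = (\<integral>u. indicator {s<..t} u * u \<partial>M)"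
      using that by (intro Bochner_Integration.integral_cong) (auto simp: indicator_def)
    finally have eq: "g t - g s = (\<integral>u. indicator {s<..t} u * u \<partial>M)" .
    have ic: "(\<integral>u. indicator {s<..t} u * c \<partial>M) = c * (f t - f s)" for c :: real
      using mea[OF that(2)] setsM by (simp add: M_def)
    have "(\<integral>u. indicator {s<..t} u * s \<partial>M) \<le> g t - g s"
      unfolding eq by (intro integral_mono ifin iind that) (auto simp: indicator_def)
    moreover have "g t - g s \<le> (\<integral>u. indicator {s<..t} u * t \<partial>M)"
      unfolding eq by (intro integral_mono ifin iind that) (auto simp: indicator_def)
    ultimately show ?thesis unfolding ic by blast
  qed
  have kd: "s * (f t - f s) \<le> k t - k s \<and> k t - k s \<le> t * (f t - f s)" if "s \<le> t" for s t
  proof -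
    interpret S: closed_subspace "F s" by (rule cs)
    interpret T: closed_subspace "F t" by (rule cs)
    define y where "y = prj (F t) x - prj (F s) x"
    have sub: "F s \<subseteq> F t" by (rule resolution_mono[OF F that])
    have yT: "y \<in> F t" unfolding y_def using S.prj_in T.prj_in sub by (intro subspace_diff[OF T.subspace]) auto
    have "y = prj (F t) x - prj (F s) (prj (F t) x)"
      unfolding y_def using prj_prj_subset(1)[OF cs cs sub] by simp
    then have yS: "y \<in> (F s)\<^sup>\<bottom>" using S.prj_diff by simp
    have AS: "A (prj (F s) x) \<in> F s" using rep S.prj_in by (auto simp: represents_def)
    have 0: "inner y (A (prj (F s) x)) = 0" using orthD(2)[OF yS AS] .
    then have "inner (prj (F s) x) (A y) = 0"
      by (simp add: selfadj_inner[OF A, symmetric] inner_commute)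
    moreover have "prj (F t) x = prj (F s) x + y" by (simp add: y_def)
    ultimately have "k t = k s + inner y (A y)"
      using 0 unfolding k_def by (simp add: linear_add[OF selfadj_linear[OF A]] inner_add)
    moreover have "inner y y = f t - f s"
      using resolution_prj_norm_diff[OF F that, of x] by (simp add: y_def f_def power2_norm_eq_inner)
    moreover have "s * inner y y \<le> inner y (A y)" "inner y (A y) \<le> t * inner y y"
      using rep yT yS by (auto simp: represents_def)
    ultimately show ?thesis by simp
  qed
  \<comment> \<open>Both increments lie in the same interval of length (t - s)(f t - f s), so the
    difference of the two functions has increments of second order and is constant on
    [a, b].\<close>
  have "g a - k a = g b - k b"
  proof (rule eq_of_small_increments[where d="\<lambda>t. g t - k t" and f=f])
    show "\<bar>g t - k t - (g s - k s)\<bar> \<le> (t - s) * (f t - f s)" if "a \<le> s" "s \<le> t" for s t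
      using gd[OF that] kd[OF that(2)] unfolding left_diff_distrib by linarith
  qed (use ab(1) in simp)
  moreover have "g a = 0" by (simp add: g_def)
  moreover have "k a = 0" using closed_subspace.prj_in[OF cs, of a x] ab(2)[of a] by (simp add: k_def)
  moreover have "k b = inner x (A x)" using closed_subspace.prj_id[OF cs, of x b] ab(3)[of b] by (simp add: k_def)
  moreover have "g b = (\<integral>u. u \<partial>M)"
    unfolding g_def by (intro integral_cong_AE Meq) (simp_all add: M_def)
  ultimately show "inner x (A x) = integral\<^sup>L (interval_measure (\<lambda>t. inner x (prj (F t) x))) (\<lambda>t. t)"
    by (simp add: M_def f_def[abs_def])
qed

lemma represents_inj:
  fixes F :: "real \<Rightarrow> 'a::{real_inner, complete_space} set"
  assumes "selfadj A" "selfadj B" "resolution J F" "represents A F" "represents B F"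
  shows "A = B"
  using assms by (intro selfadj_eqI) (simp_all add: represents_integral(2)[of _ J F])

section \<open>Projections and their ranges\<close>

lemma is_proj_prj:
  fixes M :: "'a::{real_inner, complete_space} set"
  assumes J: "complex_structure J" and M: "csub J M"
  shows "is_proj J (prj M)"
proof -
  interpret closed_subspace M by (rule csub_closed_subspace[OF M])
  show ?thesis
    by (auto simp: is_proj_def is_bsa_iff selfadj_prj closed_subspace_axioms prj_J_commute[OF J M] fun_eq_iff
        intro!: prj_id prj_in)
qed

lemma is_proj_range:
  fixes P :: "'a::{real_inner, complete_space} \<Rightarrow> 'a"
  assumes "is_proj J P"
  shows "csub J (range P)" "prj (range P) = P"
proof -
  have P: "selfadj P" and PJ: "\<And>x. P (J x) = J (P x)" and PP: "\<And>x. P (P x) = P x"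
    using assms by (auto simp: is_proj_def is_bsa_iff fun_eq_iff)
  have bl: "bounded_linear P" using P by (simp add: selfadj_def)
  have "range P = {x. P x = x}" using PP by (auto intro: sym)
  moreover have "closed {x. P x = x}"
    by (intro closed_Collect_eq linear_continuous_on[OF bl] continuous_intros)
  ultimately have cl: "closed (range P)" by simp
  have sub: "subspace (range P)" by (rule linear_subspace_image[OF selfadj_linear[OF P] subspace_UNIV])
  show c: "csub J (range P)" unfolding csub_def using cl sub PJ by (auto simp flip: PJ)
  show "prj (range P) = P"
  proof
    fix x
    have "x - P x \<in> (range P)\<^sup>\<bottom>"
      by (auto simp: orth_iff selfadj_inner[OF P] linear_diff[OF selfadj_linear[OF P]] PP)
    then show "prj (range P) x = P x"
      by (intro closed_subspace.prj_eqI[OF csub_closed_subspace[OF c]]) auto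
  qed
qed

lemma proj_le_prj_iff:
  fixes M :: "'a::{real_inner, complete_space} set"
  assumes "closed_subspace M" "closed_subspace N"
  shows "proj_le (prj M) (prj N) \<longleftrightarrow> M \<subseteq> N"
proof -
  interpret M: closed_subspace M by fact
  interpret N: closed_subspace N by fact
  show ?thesis
  proof
    assume *: "proj_le (prj M) (prj N)"
    show "M \<subseteq> N"
    proof
      fix x assume "x \<in> M"
      then have "prj N x = x" using * unfolding proj_le_def fun_eq_iff by (metis M.prj_id comp_apply)
      then show "x \<in> N" by (simp only: N.prj_fix_iff)
    qed
  next
    assume "M \<subseteq> N"
    then show "proj_le (prj M) (prj N)"
      unfolding proj_le_def fun_eq_iff using M.prj_in by (auto intro!: N.prj_id)
  qed
qed

text \<open>From left to right the family is tied to \<open>A\<close> only by the integral formula.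
  Its ranges form a resolution, which some operator represents; that operator has the same
  integrals, hence the same quadratic form, and so equals \<open>A\<close>.\<close>

theorem spectral_family_iff:
  fixes A :: "'a::{real_inner, complete_space} \<Rightarrow> 'a"
  assumes J: "complex_structure J" and bsa: "is_bsa J A"
  shows "spectral_family J A E \<longleftrightarrow> (\<exists>F. resolution J F \<and> represents A F \<and> E = (\<lambda>t. prj (F t)))"
proof
  assume "\<exists>F. resolution J F \<and> represents A F \<and> E = (\<lambda>t. prj (F t))"
  then obtain F where F: "resolution J F" "represents A F" and E: "E = (\<lambda>t. prj (F t))" by blast
  note cs = resolution_closed_subspace[OF F(1)]
  show "spectral_family J A E"
    unfolding spectral_family_def E
  proof (intro conjI allI impI)
    show "is_proj J (prj (F t))" for t by (rule is_proj_prj[OF J resolution_csub[OF F(1)]])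
    show "proj_le (prj (F s)) (prj (F t))" if "s \<le> t" for s t
      using resolution_mono[OF F(1) that] by (simp add: proj_le_prj_iff[OF cs cs])
    show "((\<lambda>s. prj (F s) x) \<longlongrightarrow> prj (F t) x) (at_right t)" for t x
      by (rule resolution_right_continuous[OF F(1)])
    obtain a b where ab: "a < b" "\<And>t. t \<le> a \<Longrightarrow> F t = {0}" "\<And>t. b \<le> t \<Longrightarrow> F t = UNIV"
      by (rule resolution_bounds[OF F(1)]) (rule that)
    have "prj (F t) = (\<lambda>x. 0)" if "t < a" for t
      using closed_subspace.prj_in[OF cs, of t] ab(2)[of t] that by auto
    moreover have "prj (F t) = id" if "b \<le> t" for t
      using closed_subspace.prj_id[OF cs, of _ t] ab(3)[OF that] by auto
    ultimately show "\<exists>a b. (\<forall>t<a. prj (F t) = (\<lambda>x. 0)) \<and> (\<forall>t\<ge>b. prj (F t) = id)" by blast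
  qed (use represents_integral[OF is_bsa_selfadj[OF bsa] F] in auto)
next
  assume "spectral_family J A E"
  then have pr: "\<And>t. is_proj J (E t)" and mono: "\<And>s t. s \<le> t \<Longrightarrow> proj_le (E s) (E t)"
    and rc: "\<And>t x. ((\<lambda>s. E s x) \<longlongrightarrow> E t x) (at_right t)"
    and bd: "\<exists>a b. (\<forall>t<a. E t = (\<lambda>x. 0)) \<and> (\<forall>t\<ge>b. E t = id)"
    and int: "\<And>x. inner x (A x) = integral\<^sup>L (interval_measure (\<lambda>t. inner x (E t x))) (\<lambda>t. t)"
    unfolding spectral_family_def by blast+
  define F where "F t = range (E t)" for t
  note csub = is_proj_range(1)[OF pr, folded F_def]
  note EF = is_proj_range(2)[OF pr, folded F_def]
  have E: "E = (\<lambda>t. prj (F t))" by (simp add: EF)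
  have F: "resolution J F"
    unfolding resolution_def
  proof (intro conjI allI impI)
    show "csub J (F t)" for t by (rule csub)
    show "F s \<subseteq> F t" if "s \<le> t" for s t
      using mono[OF that] unfolding E
      by (simp add: proj_le_prj_iff[OF csub_closed_subspace[OF csub] csub_closed_subspace[OF csub]])
    show "(\<Inter>s\<in>{t<..}. F s) \<subseteq> F t" for t
    proof
      fix x assume x: "x \<in> (\<Inter>s\<in>{t<..}. F s)"
      have "E s x = x" if "t < s" for s
        using x that closed_subspace.prj_id[OF csub_closed_subspace[OF csub], of x s] by (simp add: E)
      then have "((\<lambda>s. E s x) \<longlongrightarrow> x) (at_right t)"
        by (intro tendsto_eventually) (auto simp: eventually_at_right_less intro: eventually_mono[OF eventually_at_right_less])
      then have "E t x = x" using tendsto_unique[OF _ rc] by simp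
      then show "x \<in> F t" unfolding F_def by (metis rangeI)
    qed
    obtain a b where "\<forall>t<a. E t = (\<lambda>x. 0)" "\<forall>t\<ge>b. E t = id" using bd by blast
    then show "\<exists>a b. (\<forall>t<a. F t = {0}) \<and> (\<forall>t\<ge>b. F t = UNIV)"
      by (intro exI[of _ a] exI[of _ b]) (auto simp: F_def)
  qed
  obtain B where B: "is_bsa J B" "represents B F"
    by (rule resolution_operator[OF J F]) (rule that)
  have "B = A"
  proof (rule selfadj_eqI)
    show "inner x (B x) = inner x (A x)" for x
      using represents_integral(2)[OF is_bsa_selfadj[OF B(1)] F B(2)] int[of x] unfolding E by simp
  qed (use B bsa is_bsa_selfadj in auto)
  then show "\<exists>F. resolution J F \<and> represents A F \<and> E = (\<lambda>t. prj (F t))" using F B E by blast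
qed

definition spec_sub :: "('a::real_inner \<Rightarrow> 'a) \<Rightarrow> ('a \<Rightarrow> 'a) \<Rightarrow> real \<Rightarrow> 'a set" where
  "spec_sub J A t = range (spec J A t)"

lemma spec_eqI:
  fixes A :: "'a::{real_inner, complete_space} \<Rightarrow> 'a"
  assumes J: "complex_structure J" and A: "is_bsa J A" and F: "resolution J F" "represents A F"
  shows "spec J A = (\<lambda>t. prj (F t))" "spec_sub J A = F"
proof -
  show s: "spec J A = (\<lambda>t. prj (F t))"
    unfolding spec_def
  proof (rule the_equality)
    show "spectral_family J A (\<lambda>t. prj (F t))" using F by (auto simp: spectral_family_iff[OF J A])
    show "E = (\<lambda>t. prj (F t))" if "spectral_family J A E" for E
      using that represents_unique[OF is_bsa_selfadj[OF A] F] by (auto simp: spectral_family_iff[OF J A])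
  qed
  show "spec_sub J A = F"
    using closed_subspace.range_prj[OF resolution_closed_subspace[OF F(1)]] by (auto simp: spec_sub_def s fun_eq_iff)
qed

lemma spec_sub:
  fixes A :: "'a::{real_inner, complete_space} \<Rightarrow> 'a"
  assumes J: "complex_structure J" and A: "is_bsa J A"
  shows "resolution J (spec_sub J A)" "represents A (spec_sub J A)" "spec J A = (\<lambda>t. prj (spec_sub J A t))"
proof -
  obtain F where F: "resolution J F" "represents A F"
    by (rule spectral_theorem[OF J A]) (rule that)
  show "resolution J (spec_sub J A)" "represents A (spec_sub J A)" "spec J A = (\<lambda>t. prj (spec_sub J A t))"
    using F by (simp_all add: spec_eqI[OF J A F])
qed

lemma spec_sub_inj:
  fixes A :: "'a::{real_inner, complete_space} \<Rightarrow> 'a"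
  assumes J: "complex_structure J" and "is_bsa J A" "is_bsa J B" "spec_sub J A = spec_sub J B"
  shows "A = B"
  using represents_inj[of A B J "spec_sub J A"] spec_sub[OF J] assms is_bsa_selfadj by metis

section \<open>Effects as resolutions of the identity\<close>

text \<open>Antisymmetry turns universal properties into lattice identities. The second conclusion
  identifies the order read off from the meet with the given one, so that later arguments can use
  the latter.\<close>

lemma bounded_lattice_algI:
  fixes le :: "'b \<Rightarrow> 'b \<Rightarrow> bool"
  assumes refl: "\<And>x. x \<in> C \<Longrightarrow> le x x"
    and trans: "\<And>x y w. x \<in> C \<Longrightarrow> y \<in> C \<Longrightarrow> w \<in> C \<Longrightarrow> le x y \<Longrightarrow> le y w \<Longrightarrow> le x w"
    and antisym: "\<And>x y. x \<in> C \<Longrightarrow> y \<in> C \<Longrightarrow> le x y \<Longrightarrow> le y x \<Longrightarrow> x = y"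
    and m: "\<And>x y. x \<in> C \<Longrightarrow> y \<in> C \<Longrightarrow> m x y \<in> C" "\<And>x y. x \<in> C \<Longrightarrow> y \<in> C \<Longrightarrow> le (m x y) x"
      "\<And>x y. x \<in> C \<Longrightarrow> y \<in> C \<Longrightarrow> le (m x y) y"
      "\<And>x y w. x \<in> C \<Longrightarrow> y \<in> C \<Longrightarrow> w \<in> C \<Longrightarrow> le w x \<Longrightarrow> le w y \<Longrightarrow> le w (m x y)"
    and j: "\<And>x y. x \<in> C \<Longrightarrow> y \<in> C \<Longrightarrow> j x y \<in> C" "\<And>x y. x \<in> C \<Longrightarrow> y \<in> C \<Longrightarrow> le x (j x y)"
      "\<And>x y. x \<in> C \<Longrightarrow> y \<in> C \<Longrightarrow> le y (j x y)"
      "\<And>x y w. x \<in> C \<Longrightarrow> y \<in> C \<Longrightarrow> w \<in> C \<Longrightarrow> le x w \<Longrightarrow> le y w \<Longrightarrow> le (j x y) w"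
    and z: "z \<in> C" "\<And>x. x \<in> C \<Longrightarrow> le z x" and u: "u \<in> C" "\<And>x. x \<in> C \<Longrightarrow> le x u"
  shows "bounded_lattice_alg C m j z u"
    and "\<And>x y. x \<in> C \<Longrightarrow> y \<in> C \<Longrightarrow> lat_le m x y \<longleftrightarrow> le x y"
proof -
  have massoc: "m x (m y w) = m (m x y) w" if "x \<in> C" "y \<in> C" "w \<in> C" for x y w
  proof (rule antisym)
    show "le (m x (m y w)) (m (m x y) w)" using that by (intro m; meson m trans)
    show "le (m (m x y) w) (m x (m y w))" using that by (intro m; meson m trans)
  qed (use that m in auto)
  have jassoc: "j x (j y w) = j (j x y) w" if "x \<in> C" "y \<in> C" "w \<in> C" for x y w
  proof (rule antisym)
    show "le (j x (j y w)) (j (j x y) w)" using that by (intro j; meson j trans)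
    show "le (j (j x y) w) (j x (j y w))" using that by (intro j; meson j trans)
  qed (use that j in auto)
  have comm: "m x y = m y x" "j x y = j y x" if "x \<in> C" "y \<in> C" for x y
    using that by (auto intro!: antisym m j)
  have absorb: "m x (j x y) = x" "j x (m x y) = x" if "x \<in> C" "y \<in> C" for x y
    using that by (auto intro!: antisym m j refl)
  have bnd: "m z x = z" "j u x = u" if "x \<in> C" for x
    using that by (auto intro!: antisym m j z u refl)
  show "bounded_lattice_alg C m j z u"
    unfolding bounded_lattice_alg_def
    by (intro conjI ballI; rule massoc jassoc comm absorb bnd m(1) j(1) z(1) u(1); assumption)
  show "lat_le m x y \<longleftrightarrow> le x y" if "x \<in> C" "y \<in> C" for x y
  proof
    show "le x y" if "lat_le m x y"
      using m(3)[OF \<open>x \<in> C\<close> \<open>y \<in> C\<close>] that by (simp add: lat_le_def)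
    show "lat_le m x y" if "le x y"
      unfolding lat_le_def
      by (rule antisym) (use \<open>x \<in> C\<close> \<open>y \<in> C\<close> that in \<open>auto intro: m refl\<close>)
  qed
qed

lemma mult_le_of_less:
  fixes c d t :: real
  assumes "\<And>s. s < t \<Longrightarrow> s * c \<le> d"
  shows "t * c \<le> d"
proof (rule tendsto_upperbound[where F="at_left t" and f="\<lambda>s. s * c"])
  show "((\<lambda>s. s * c) \<longlongrightarrow> t * c) (at_left t)" by (intro tendsto_intros)
  show "\<forall>\<^sub>F s in at_left t. s * c \<le> d"
    using assms by (auto simp: eventually_at intro!: exI[of _ 1])
qed simp

section \<open>Lattice operations on closed complex subspaces\<close>

locale complex_hilbert =
  fixes J :: "'a::{real_inner, complete_space} \<Rightarrow> 'a"
  assumes J: "complex_structure J"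
begin

abbreviation L :: "('a \<Rightarrow> 'a) \<Rightarrow> real \<Rightarrow> 'a set" where "L \<equiv> spec_sub J"
abbreviation E :: "('a \<Rightarrow> 'a) set" where "E \<equiv> effects J"

text \<open>The lattice join of closed complex subspaces, taken as an intersection because the
  algebraic sum of two closed subspaces need not be closed.\<close>

definition hull2 :: "'a set \<Rightarrow> 'a set \<Rightarrow> 'a set" where
  "hull2 M N = \<Inter>{K. csub J K \<and> M \<subseteq> K \<and> N \<subseteq> K}"

lemma csub_Inter: "(\<And>M. M \<in> \<M> \<Longrightarrow> csub J M) \<Longrightarrow> csub J (\<Inter>\<M>)"
  by (auto simp: csub_def intro!: closed_Inter subspace_Inter)

lemma csub_UNIV: "csub J UNIV"
  by (simp add: csub_def subspace_UNIV)

lemma csub_zero: "csub J {0}"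
  using J by (auto simp: csub_def complex_structure_def linear_0 subspace_def)

lemma csub_hull2: "csub J (hull2 M N)"
  unfolding hull2_def by (rule csub_Inter) auto

lemma hull2_upper: "M \<subseteq> hull2 M N" "N \<subseteq> hull2 M N"
  by (auto simp: hull2_def)

lemma hull2_least: "csub J K \<Longrightarrow> M \<subseteq> K \<Longrightarrow> N \<subseteq> K \<Longrightarrow> hull2 M N \<subseteq> K"
  by (auto simp: hull2_def)

text \<open>An orthogonal sum of closed subspaces is already closed, so no closure has to be
  taken.\<close>

lemma hull2_orth:
  assumes M: "csub J M" and N: "csub J N" and MN: "N \<subseteq> M\<^sup>\<bottom>"
  shows "hull2 M N = {u + v |u v. u \<in> M \<and> v \<in> N}"
proof
  have "closed_subspace {u + v |u v. u \<in> M \<and> v \<in> N}"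
    by (intro closed_subspace_orth_sum csub_closed_subspace[OF M] csub_closed_subspace[OF N] MN)
  moreover have "J (u + v) = J u + J v" for u v using J by (simp add: complex_structure_def linear_add)
  ultimately have "csub J {u + v |u v. u \<in> M \<and> v \<in> N}"
    using M N by (fastforce simp: csub_def closed_subspace_def)
  moreover have "0 \<in> M" "0 \<in> N" using M N subspace_0 by (auto simp: csub_def)
  then have "M \<subseteq> {u + v |u v. u \<in> M \<and> v \<in> N}" "N \<subseteq> {u + v |u v. u \<in> M \<and> v \<in> N}"
    by force+
  ultimately show "hull2 M N \<subseteq> {u + v |u v. u \<in> M \<and> v \<in> N}" by (rule hull2_least)
  show "{u + v |u v. u \<in> M \<and> v \<in> N} \<subseteq> hull2 M N"
    using hull2_upper[of M N] hull2_upper(2)[of N M] csub_hull2[of M N]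
    by (auto simp: csub_def intro!: subspace_add)
qed

text \<open>Passing to ranges turns \<open>proj_le\<close> into inclusion, where the intersection is
  the greatest lower bound. The empty family is covered, with the projection onto the whole
  space.\<close>

lemma proj_Inf_prj:
  assumes "\<And>M. M \<in> \<M> \<Longrightarrow> csub J M"
  shows "proj_Inf J (prj ` \<M>) = prj (\<Inter>\<M>)"
  unfolding proj_Inf_def
proof (rule the_equality)
  have c: "csub J (\<Inter>\<M>)" by (rule csub_Inter[OF assms])
  have le: "proj_le R (prj M) \<longleftrightarrow> range R \<subseteq> M" if "is_proj J R" "csub J M" for R M
    using is_proj_range[OF that(1)] proj_le_prj_iff[OF csub_closed_subspace csub_closed_subspace, of J "range R" J M] that
    by simp
  have rng: "range (prj (\<Inter>\<M>)) = \<Inter>\<M>" by (rule closed_subspace.range_prj[OF csub_closed_subspace[OF c]])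
  have p: "is_proj J (prj (\<Inter>\<M>))" by (rule is_proj_prj[OF J c])
  show *: "is_proj J (prj (\<Inter>\<M>)) \<and> (\<forall>Q\<in>prj ` \<M>. proj_le (prj (\<Inter>\<M>)) Q) \<and>
      (\<forall>R. is_proj J R \<and> (\<forall>Q\<in>prj ` \<M>. proj_le R Q) \<longrightarrow> proj_le R (prj (\<Inter>\<M>)))"
  proof (intro conjI allI ballI impI p)
    show "proj_le (prj (\<Inter>\<M>)) Q" if "Q \<in> prj ` \<M>" for Q
      using that le[OF p assms] unfolding rng by auto
    show "proj_le R (prj (\<Inter>\<M>))" if R: "is_proj J R \<and> (\<forall>Q\<in>prj ` \<M>. proj_le R Q)" for R
    proof -
      have "range R \<subseteq> M" if "M \<in> \<M>" for M
        using R le[of R, OF _ assms[OF that]] that by blast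
      then show ?thesis using le[of R, OF _ c] R by blast
    qed
  qed
  fix P assume P: "is_proj J P \<and> (\<forall>Q\<in>prj ` \<M>. proj_le P Q) \<and>
      (\<forall>R. is_proj J R \<and> (\<forall>Q\<in>prj ` \<M>. proj_le R Q) \<longrightarrow> proj_le R P)"
  then have "proj_le P (prj (\<Inter>\<M>))" "proj_le (prj (\<Inter>\<M>)) P" using * by blast+
  moreover have "proj_le (prj (\<Inter>\<M>)) (prj (range P)) \<longleftrightarrow> range (prj (\<Inter>\<M>)) \<subseteq> range P"
    by (rule le[OF p is_proj_range(1)]) (use P in blast)
  ultimately have "range P = \<Inter>\<M>"
    using P is_proj_range(2)[of J P] le[of P, OF _ c] unfolding rng by auto
  then show "P = prj (\<Inter>\<M>)" using P is_proj_range(2)[of J P] by auto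
qed

lemma proj_inf_prj: "csub J M \<Longrightarrow> csub J N \<Longrightarrow> proj_inf J (prj M) (prj N) = prj (M \<inter> N)"
  using proj_Inf_prj[of "{M, N}"] by (auto simp: proj_inf_def)

lemma proj_sup_prj:
  assumes M: "csub J M" and N: "csub J N"
  shows "proj_sup J (prj M) (prj N) = prj (hull2 M N)"
  unfolding proj_sup_def proj_Sup_def
proof (rule the_equality)
  have le: "proj_le (prj K) R \<longleftrightarrow> K \<subseteq> range R" if "is_proj J R" "csub J K" for R K
    using is_proj_range[OF that(1)] proj_le_prj_iff[OF csub_closed_subspace csub_closed_subspace, of J K J "range R"] that
    by simp
  have rng: "range (prj (hull2 M N)) = hull2 M N"
    by (rule closed_subspace.range_prj[OF csub_closed_subspace[OF csub_hull2]])
  have p: "is_proj J (prj (hull2 M N))" by (rule is_proj_prj[OF J csub_hull2])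
  show *: "is_proj J (prj (hull2 M N)) \<and> (\<forall>Q\<in>{prj M, prj N}. proj_le Q (prj (hull2 M N))) \<and>
      (\<forall>R. is_proj J R \<and> (\<forall>Q\<in>{prj M, prj N}. proj_le Q R) \<longrightarrow> proj_le (prj (hull2 M N)) R)"
  proof (intro conjI allI ballI impI p)
    show "proj_le Q (prj (hull2 M N))" if "Q \<in> {prj M, prj N}" for Q
      using that le[OF p M] le[OF p N] hull2_upper(1)[of M N] hull2_upper(2)[of N M] unfolding rng by auto
    show "proj_le (prj (hull2 M N)) R" if R: "is_proj J R \<and> (\<forall>Q\<in>{prj M, prj N}. proj_le Q R)" for R
    proof -
      have "M \<subseteq> range R" "N \<subseteq> range R" using R le[of R, OF _ M] le[of R, OF _ N] by auto
      then show ?thesis using hull2_least[OF is_proj_range(1)] le[of R, OF _ csub_hull2] R by auto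
    qed
  qed
  fix P assume P: "is_proj J P \<and> (\<forall>Q\<in>{prj M, prj N}. proj_le Q P) \<and>
      (\<forall>R. is_proj J R \<and> (\<forall>Q\<in>{prj M, prj N}. proj_le Q R) \<longrightarrow> proj_le P R)"
  then have "proj_le P (prj (hull2 M N))" "proj_le (prj (hull2 M N)) P" using * by blast+
  moreover have "proj_le (prj (range P)) (prj (hull2 M N)) \<longleftrightarrow> range P \<subseteq> range (prj (hull2 M N))"
    by (rule le[OF p is_proj_range(1)]) (use P in blast)
  ultimately have "range P = hull2 M N"
    using P is_proj_range(2)[of J P] le[of P, OF _ csub_hull2] unfolding rng by auto
  then show "P = prj (hull2 M N)" using P is_proj_range(2)[of J P] by auto
qed

text \<open>The resolutions belonging to effects. The strict bound at 0 leaves room for the kernel,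
  which is the subspace at level 0; at level 1 the whole space must be reached.\<close>

definition eres :: "(real \<Rightarrow> 'a set) \<Rightarrow> bool" where
  "eres F \<longleftrightarrow> resolution J F \<and> (\<forall>t<0. F t = {0}) \<and> (\<forall>t\<ge>1. F t = UNIV)"

lemma eresI:
  assumes "\<And>t. csub J (F t)" "\<And>s t. s \<le> t \<Longrightarrow> F s \<subseteq> F t" "\<And>t x. (\<And>s. t < s \<Longrightarrow> x \<in> F s) \<Longrightarrow> x \<in> F t"
    "\<And>t. t < 0 \<Longrightarrow> F t \<subseteq> {0}" "\<And>t. t \<ge> 1 \<Longrightarrow> F t = UNIV"
  shows "eres F"
proof -
  have 0: "0 \<in> F t" for t using assms(1) subspace_0 by (auto simp: csub_def)
  have *: "\<forall>t<0. F t = {0}" using assms(4) 0 by blast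
  have "resolution J F"
    unfolding resolution_def
  proof (intro conjI allI impI)
    show "(\<Inter>s\<in>{t<..}. F s) \<subseteq> F t" for t using assms(3) by blast
    show "\<exists>a b. (\<forall>t<a. F t = {0}) \<and> (\<forall>t\<ge>b. F t = UNIV)" using * assms(5) by blast
  qed (use assms in auto)
  then show ?thesis using * assms(5) by (simp add: eres_def)
qed

lemma effect_bsa: "A \<in> E \<Longrightarrow> is_bsa J A"
  by (simp add: effects_def)

lemma resolution_L: "A \<in> E \<Longrightarrow> resolution J (L A)"
  and represents_L: "A \<in> E \<Longrightarrow> represents A (L A)"
  using spec_sub[OF J effect_bsa] by auto

lemma csub_L: "A \<in> E \<Longrightarrow> csub J (L A t)"
  using resolution_L resolution_csub by blast

lemma subspace_L: "A \<in> E \<Longrightarrow> subspace (L A t)"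
  using csub_L by (auto simp: csub_def)

lemma L_mono: "A \<in> E \<Longrightarrow> s \<le> t \<Longrightarrow> L A s \<subseteq> L A t"
  using resolution_L resolution_mono by blast

lemma L_right: "A \<in> E \<Longrightarrow> (\<And>s. t < s \<Longrightarrow> x \<in> L A s) \<Longrightarrow> x \<in> L A t"
  using resolution_right[OF resolution_L] by blast

lemma effect_iff_eres:
  assumes A: "is_bsa J A"
  shows "A \<in> E \<longleftrightarrow> eres (L A)"
proof
  note res = spec_sub(1)[OF J A]
  have low: "\<And>t x. x \<in> L A t \<Longrightarrow> inner x (A x) \<le> t * inner x x"
    and upp: "\<And>t x. x \<in> (L A t)\<^sup>\<bottom> \<Longrightarrow> t * inner x x \<le> inner x (A x)"
    using spec_sub(2)[OF J A] by (auto simp: represents_def)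
  note cs = resolution_closed_subspace[OF res]
  show "eres (L A)" if "A \<in> E"
  proof (rule eresI)
    have eff: "0 \<le> inner x (A x)" "inner x (A x) \<le> inner x x" for x using that by (auto simp: effects_def)
    show "L A t \<subseteq> {0}" if "t < 0" for t
    proof
      fix x assume "x \<in> L A t"
      then have "0 \<le> t * inner x x" using low eff(1) order_trans by blast
      then have "inner x x \<le> 0" using \<open>t < 0\<close> by (simp add: zero_le_mult_iff)
      then have "inner x x = 0" using inner_ge_zero[of x] by (rule order_antisym)
      then show "x \<in> {0}" by simp
    qed
    \<comment> \<open>The lower bound t on the complement contradicts A \<le> I only when t > 1;
      level 1 itself follows by right-continuity.\<close>
    have gt: "L A t = UNIV" if "t > 1" for t
    proof -
      have "x = 0" if "x \<in> (L A t)\<^sup>\<bottom>" for x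
      proof -
        have "t * inner x x \<le> 1 * inner x x" using upp[OF that] eff(2)[of x] by simp
        then have "(t - 1) * inner x x \<le> 0" by (simp add: left_diff_distrib)
        then have "inner x x \<le> 0" using \<open>t > 1\<close> by (simp add: mult_le_0_iff)
        then have "inner x x = 0" using inner_ge_zero[of x] by (rule order_antisym)
        then show ?thesis by simp
      qed
      then have "(L A t)\<^sup>\<bottom> = {0}" using subspace_0[OF subspace_orthogonal_comp] by blast
      then show ?thesis using closed_subspace.eq_UNIV_iff[OF cs] by blast
    qed
    show "L A t = UNIV" if "t \<ge> 1" for t
    proof -
      have "x \<in> L A t" for x using resolution_right[OF res, of t x] gt that by fastforce
      then show ?thesis by blast
    qed
  qed (fact resolution_csub[OF res] resolution_mono[OF res] resolution_right[OF res])+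
  show "A \<in> E" if "eres (L A)"
  proof -
    have "0 \<le> inner x (A x)" for x
    proof -
      have "s * inner x x \<le> inner x (A x)" if "s < 0" for s
        using upp[of x s] \<open>eres (L A)\<close> that by (simp add: eres_def)
      then have "0 * inner x x \<le> inner x (A x)" by (rule mult_le_of_less)
      then show ?thesis by simp
    qed
    moreover have "inner x (A x) \<le> inner x x" for x
      using low[of x 1] \<open>eres (L A)\<close> by (simp add: eres_def)
    ultimately show ?thesis using A by (simp add: effects_def)
  qed
qed

lemma eres_L: "A \<in> E \<Longrightarrow> eres (L A)"
  using effect_iff_eres effect_bsa by blast

lemma L_neg: "A \<in> E \<Longrightarrow> t < 0 \<Longrightarrow> L A t = {0}"
  and L_ge_1: "A \<in> E \<Longrightarrow> t \<ge> 1 \<Longrightarrow> L A t = UNIV"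
  using eres_L by (auto simp: eres_def)

lemma L_inj: "A \<in> E \<Longrightarrow> B \<in> E \<Longrightarrow> L A = L B \<Longrightarrow> A = B"
  using spec_sub_inj[OF J effect_bsa effect_bsa] by blast

lemma eres_effect:
  assumes "eres F"
  shows "\<exists>A\<in>E. L A = F"
proof -
  have F: "resolution J F" using assms by (simp add: eres_def)
  obtain A where A: "is_bsa J A" "represents A F"
    by (rule resolution_operator[OF J F]) (rule that)
  have "L A = F" by (rule spec_eqI(2)[OF J A(1) F A(2)])
  then show ?thesis using effect_iff_eres[OF A(1)] assms by blast
qed

lemma THE_spec:
  assumes F: "eres F"
  shows "(THE C. is_bsa J C \<and> spec J C = (\<lambda>t. prj (F t))) \<in> E"
    and "L (THE C. is_bsa J C \<and> spec J C = (\<lambda>t. prj (F t))) = F"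
proof -
  obtain A where A: "A \<in> E" "L A = F" using eres_effect[OF F] by blast
  have "(THE C. is_bsa J C \<and> spec J C = (\<lambda>t. prj (F t))) = A"
  proof (rule the_equality)
    show s: "is_bsa J A \<and> spec J A = (\<lambda>t. prj (F t))"
      using A effect_bsa spec_sub(3)[OF J effect_bsa[OF A(1)]] by auto
    show "C = A" if "is_bsa J C \<and> spec J C = (\<lambda>t. prj (F t))" for C
      by (rule spec_sub_inj[OF J]) (use that s in \<open>auto simp: spec_sub_def fun_eq_iff\<close>)
  qed
  then show "(THE C. is_bsa J C \<and> spec J C = (\<lambda>t. prj (F t))) \<in> E"
    and "L (THE C. is_bsa J C \<and> spec J C = (\<lambda>t. prj (F t))) = F" using A by auto
qed

lemma join_s_spec:
  assumes A: "A \<in> E" and B: "B \<in> E"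
  shows "join_s J A B \<in> E" "L (join_s J A B) = (\<lambda>t. L A t \<inter> L B t)"
proof -
  have "eres (\<lambda>t. L A t \<inter> L B t)"
  proof (rule eresI)
    show "csub J (L A t \<inter> L B t)" for t
      using csub_Inter[of "{L A t, L B t}"] csub_L A B by auto
    show "x \<in> L A t \<inter> L B t" if "\<And>s. t < s \<Longrightarrow> x \<in> L A s \<inter> L B s" for t x
      using that L_right[OF A, of t x] L_right[OF B, of t x] by blast
    show "L A s \<inter> L B s \<subseteq> L A t \<inter> L B t" if "s \<le> t" for s t
      using L_mono[OF A that] L_mono[OF B that] by blast
  qed (simp_all add: L_neg L_ge_1 A B)
  moreover have "join_s J A B = (THE C. is_bsa J C \<and> spec J C = (\<lambda>t. prj (L A t \<inter> L B t)))"
    by (simp add: join_s_def spec_sub(3)[OF J effect_bsa[OF A]] spec_sub(3)[OF J effect_bsa[OF B]]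
        proj_inf_prj csub_L A B)
  ultimately show "join_s J A B \<in> E" "L (join_s J A B) = (\<lambda>t. L A t \<inter> L B t)"
    using THE_spec by simp_all
qed

lemma meet_s_spec:
  assumes A: "A \<in> E" and B: "B \<in> E"
  shows "meet_s J A B \<in> E" "L (meet_s J A B) = (\<lambda>t. \<Inter>m\<in>{t<..}. hull2 (L A m) (L B m))"
proof -
  have "eres (\<lambda>t. \<Inter>m\<in>{t<..}. hull2 (L A m) (L B m))"
  proof (rule eresI)
    show "csub J (\<Inter>m\<in>{t<..}. hull2 (L A m) (L B m))" for t
      by (rule csub_Inter) (auto simp: csub_hull2)
    show "x \<in> (\<Inter>m\<in>{t<..}. hull2 (L A m) (L B m))"
      if x: "\<And>s. t < s \<Longrightarrow> x \<in> (\<Inter>m\<in>{s<..}. hull2 (L A m) (L B m))" for t x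
    proof
      fix m assume "m \<in> {t<..}"
      then obtain s where "t < s" "s < m" using dense by auto
      then show "x \<in> hull2 (L A m) (L B m)" using x by auto
    qed
    show "(\<Inter>m\<in>{t<..}. hull2 (L A m) (L B m)) \<subseteq> {0}" if "t < 0" for t
    proof -
      have "hull2 (L A (t/2)) (L B (t/2)) \<subseteq> {0}"
        using L_neg[OF A, of "t/2"] L_neg[OF B, of "t/2"] that by (intro hull2_least csub_zero) auto
      then show ?thesis using that by (intro INF_lower2[of "t/2"]) auto
    qed
    show "(\<Inter>m\<in>{t<..}. hull2 (L A m) (L B m)) = UNIV" if "t \<ge> 1" for t
    proof -
      have "hull2 (L A m) (L B m) = UNIV" if "m > t" for m
        using hull2_upper(1)[of "L A m" "L B m"] L_ge_1[OF A, of m] that \<open>t \<ge> 1\<close> by auto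
      then show ?thesis by auto
    qed
  qed auto
  moreover have "meet_s J A B = (THE C. is_bsa J C \<and> spec J C = (\<lambda>t. prj (\<Inter>m\<in>{t<..}. hull2 (L A m) (L B m))))"
  proof -
    have "{proj_sup J (spec J A m) (spec J B m) |m. m > t} = prj ` (\<lambda>m. hull2 (L A m) (L B m)) ` {t<..}" for t
      by (auto simp: spec_sub(3)[OF J effect_bsa[OF A]] spec_sub(3)[OF J effect_bsa[OF B]] proj_sup_prj csub_L A B)
    moreover have "proj_Inf J (prj ` (\<lambda>m. hull2 (L A m) (L B m)) ` {t<..})
        = prj (\<Inter>m\<in>{t<..}. hull2 (L A m) (L B m))" for t
      by (rule proj_Inf_prj) (auto simp: csub_hull2)
    ultimately show ?thesis by (simp only: meet_s_def)
  qed
  ultimately show "meet_s J A B \<in> E" "L (meet_s J A B) = (\<lambda>t. \<Inter>m\<in>{t<..}. hull2 (L A m) (L B m))"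
    using THE_spec by simp_all
qed

lemma op_compl_effect:
  assumes A: "A \<in> E"
  shows "op_compl A \<in> E"
proof -
  have "is_bsa J (op_compl A)"
    using selfadj_diff[OF selfadj_id is_bsa_selfadj[OF effect_bsa[OF A]]] effect_bsa[OF A] J
    by (simp add: is_bsa_iff op_compl_def complex_structure_def linear_diff)
  then show ?thesis using A by (auto simp: effects_def op_compl_def inner_diff)
qed

text \<open>The reflection t -> 1 - t turns right-continuity into left-continuity, so the
  complements are taken at all levels below 1 - t instead of at 1 - t. In this way the eigenspace of
  \<open>A\<close> for 1 - t belongs to level t of I - A.\<close>

lemma op_compl_spec:
  assumes A: "A \<in> E"
  shows "L (op_compl A) = (\<lambda>t. \<Inter>s\<in>{..<1 - t}. (L A s)\<^sup>\<bottom>)"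
proof (rule spec_eqI(2)[OF J effect_bsa[OF op_compl_effect[OF A]]])
  let ?G = "\<lambda>t. \<Inter>s\<in>{..<1 - t}. (L A s)\<^sup>\<bottom>"
  have "eres ?G"
  proof (rule eresI)
    show "csub J (?G t)" for t
      by (rule csub_Inter) (auto intro!: csub_orth J csub_L A)
    show "x \<in> ?G t" if x: "\<And>u. t < u \<Longrightarrow> x \<in> ?G u" for t x
    proof
      fix s assume "s \<in> {..<1 - t}"
      then obtain r where "s < r" "r < 1 - t" using dense by auto
      then show "x \<in> (L A s)\<^sup>\<bottom>" using x[of "1 - r"] by auto
    qed
    show "?G t \<subseteq> {0}" if "t < 0" for t
      using L_ge_1[OF A, of 1] that by (intro INF_lower2[of 1]) auto
    show "?G t = UNIV" if "t \<ge> 1" for t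
      using L_neg[OF A] that by auto
  qed auto
  then show "resolution J ?G" by (simp add: eres_def)
  have sa: "selfadj A" by (rule is_bsa_selfadj[OF effect_bsa[OF A]])
  have inv: "\<And>t x. x \<in> L A t \<Longrightarrow> A x \<in> L A t" and low: "\<And>t x. x \<in> L A t \<Longrightarrow> inner x (A x) \<le> t * inner x x"
    and upp: "\<And>t x. x \<in> (L A t)\<^sup>\<bottom> \<Longrightarrow> t * inner x x \<le> inner x (A x)"
    using represents_L[OF A] by (auto simp: represents_def)
  show "represents (op_compl A) ?G"
    unfolding represents_def
  proof (intro allI conjI ballI)
    fix t x
    show "op_compl A x \<in> ?G t" if "x \<in> ?G t"
      using that selfadj_orth_invariant[OF sa inv]
      by (auto simp: op_compl_def intro!: subspace_diff[OF subspace_orthogonal_comp])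
    show "inner x (op_compl A x) \<le> t * inner x x" if "x \<in> ?G t"
    proof -
      have "(1 - t) * inner x x \<le> inner x (A x)"
        by (rule mult_le_of_less) (use that upp in auto)
      then show ?thesis by (simp add: op_compl_def inner_diff left_diff_distrib)
    qed
    show "t * inner x x \<le> inner x (op_compl A x)" if "x \<in> (?G t)\<^sup>\<bottom>"
    proof -
      \<comment> \<open>Taking complements of this inclusion moves \<open>x\<close> into the double
        complement of \<open>L A (1 - t)\<close>, on which A \<le> 1 - t.\<close>
      have "(L A (1 - t))\<^sup>\<bottom> \<subseteq> ?G t"
        using orth_antimono[OF L_mono[OF A]] by (auto dest: less_imp_le)
      then have "x \<in> (L A (1 - t))\<^sup>\<bottom>\<^sup>\<bottom>" using that orth_antimono by blast
      then have "x \<in> L A (1 - t)"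
        using closed_subspace.biorth[OF csub_closed_subspace[OF csub_L[OF A]]] by simp
      from low[OF this] show ?thesis by (simp add: op_compl_def inner_diff left_diff_distrib)
    qed
  qed
qed

lemma scalar_effect:
  assumes "0 \<le> c" "c \<le> 1"
  shows "(\<lambda>x. c *\<^sub>R x) \<in> E" "L (\<lambda>x. c *\<^sub>R x) = (\<lambda>t. if t < c then {0} else UNIV)"
proof -
  have bsa: "is_bsa J (\<lambda>x. c *\<^sub>R x)"
    using J by (simp add: is_bsa_iff selfadj_scaleR complex_structure_def linear_scale)
  show "(\<lambda>x. c *\<^sub>R x) \<in> E"
    using bsa assms by (auto simp: effects_def mult_left_le_one_le)
  show "L (\<lambda>x. c *\<^sub>R x) = (\<lambda>t. if t < c then {0} else UNIV)"
  proof (rule spec_eqI(2)[OF J bsa])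
    have "eres (\<lambda>t. if t < c then {0} else UNIV)"
    proof (rule eresI)
      show "x \<in> (if t < c then {0} else UNIV)" if x: "\<And>s. t < s \<Longrightarrow> x \<in> (if s < c then {0} else UNIV)" for t :: real and x :: 'a
      proof (cases "t < c")
        case True
        then obtain s where "t < s" "s < c" using dense by auto
        then show ?thesis using x[of s] True by auto
      qed simp
    qed (use assms csub_zero csub_UNIV in auto)
    then show "resolution J (\<lambda>t. if t < c then {0} else UNIV)" by (simp add: eres_def)
    show "represents (\<lambda>x. c *\<^sub>R x) (\<lambda>t. if t < c then {0} else UNIV)"
      by (auto simp: represents_def mult_right_mono)
  qed
qed

subsection \<open>The spectral lattice of effects\<close>

definition le :: "('a \<Rightarrow> 'a) \<Rightarrow> ('a \<Rightarrow> 'a) \<Rightarrow> bool" where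
  "le A B \<longleftrightarrow> (\<forall>t. L B t \<subseteq> L A t)"

abbreviation "meet \<equiv> meet_s J"
abbreviation "join \<equiv> join_s J"

lemmas meet_E = meet_s_spec(1) and join_E = join_s_spec(1) and compl_E = op_compl_effect

lemma L_join: "A \<in> E \<Longrightarrow> B \<in> E \<Longrightarrow> L (join A B) t = L A t \<inter> L B t"
  by (simp add: join_s_spec(2))

lemma L_meet: "A \<in> E \<Longrightarrow> B \<in> E \<Longrightarrow> L (meet A B) t = (\<Inter>m\<in>{t<..}. hull2 (L A m) (L B m))"
  by (simp add: meet_s_spec(2))

lemma L_compl: "A \<in> E \<Longrightarrow> L (op_compl A) t = (\<Inter>s\<in>{..<1 - t}. (L A s)\<^sup>\<bottom>)"
  by (simp add: op_compl_spec)

lemma le_refl: "le A A"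
  by (simp add: le_def)

lemma le_trans: "le A B \<Longrightarrow> le B C \<Longrightarrow> le A C"
  unfolding le_def by blast

lemma le_antisym: "A \<in> E \<Longrightarrow> B \<in> E \<Longrightarrow> le A B \<Longrightarrow> le B A \<Longrightarrow> A = B"
  unfolding le_def by (rule L_inj) (auto simp: fun_eq_iff)

lemma le_join: "A \<in> E \<Longrightarrow> B \<in> E \<Longrightarrow> le A (join A B)" "A \<in> E \<Longrightarrow> B \<in> E \<Longrightarrow> le B (join A B)"
  by (simp_all add: le_def L_join)

lemma join_le: "A \<in> E \<Longrightarrow> B \<in> E \<Longrightarrow> le A C \<Longrightarrow> le B C \<Longrightarrow> le (join A B) C"
  by (simp add: le_def L_join)

lemma meet_le:
  assumes A: "A \<in> E" and B: "B \<in> E"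
  shows "le (meet A B) A" "le (meet A B) B"
proof -
  have "L A t \<subseteq> L (meet A B) t" "L B t \<subseteq> L (meet A B) t" for t
    unfolding L_meet[OF A B]
    using L_mono[OF A, of t] L_mono[OF B, of t] hull2_upper(1)[of "L A m" "L B m" for m] hull2_upper(2)[of "L B m" "L A m" for m]
    by (meson INF_greatest greaterThan_iff less_imp_le order_trans)+
  then show "le (meet A B) A" "le (meet A B) B" by (simp_all add: le_def)
qed

lemma le_meet:
  assumes A: "A \<in> E" and B: "B \<in> E" and C: "C \<in> E" and "le C A" "le C B"
  shows "le C (meet A B)"
  unfolding le_def L_meet[OF A B]
proof (intro allI subsetI)
  fix t x assume x: "x \<in> (\<Inter>m\<in>{t<..}. hull2 (L A m) (L B m))"
  have sub: "hull2 (L A m) (L B m) \<subseteq> L C m" for m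
    by (rule hull2_least[OF csub_L[OF C]]) (use assms in \<open>simp_all add: le_def\<close>)
  have "x \<in> L C m" if "t < m" for m using x sub[of m] that by auto
  then show "x \<in> L C t" by (rule L_right[OF C])
qed

lemma compl_compl: "op_compl (op_compl A) = A"
  by (simp add: op_compl_def)

lemma compl_antimono:
  assumes A: "A \<in> E" and B: "B \<in> E" and "le A B"
  shows "le (op_compl B) (op_compl A)"
  unfolding le_def L_compl[OF A] L_compl[OF B]
  using assms(3) by (intro allI INF_superset_mono[OF subset_refl] orth_antimono) (simp add: le_def)

lemma L_compl_orth: "A \<in> E \<Longrightarrow> s < 1 - t \<Longrightarrow> L (op_compl A) t \<subseteq> (L A s)\<^sup>\<bottom>"
  by (auto simp: L_compl)

text \<open>De Morgan follows from the order alone, as the complement is an antitone involution; no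
  hull has to be computed.\<close>

lemma compl_meet:
  assumes A: "A \<in> E" and B: "B \<in> E"
  shows "op_compl (meet A B) = join (op_compl A) (op_compl B)"
proof (rule le_antisym)
  note E = meet_E[OF A B] compl_E[OF A] compl_E[OF B] join_E[OF compl_E[OF A] compl_E[OF B]]
  show "le (join (op_compl A) (op_compl B)) (op_compl (meet A B))"
    by (intro join_le compl_antimono meet_le E A B)
  have "le (op_compl (join (op_compl A) (op_compl B))) (op_compl (op_compl A))"
    "le (op_compl (join (op_compl A) (op_compl B))) (op_compl (op_compl B))"
    by (intro compl_antimono le_join E)+
  then have "le (op_compl (join (op_compl A) (op_compl B))) (meet A B)"
    unfolding compl_compl by (intro le_meet A B compl_E E)
  from compl_antimono[OF compl_E[OF E(4)] E(1) this]
  show "le (op_compl (meet A B)) (join (op_compl A) (op_compl B))" by (simp add: compl_compl)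
qed (intro compl_E meet_E join_E A B)+

lemma compl_join:
  assumes A: "A \<in> E" and B: "B \<in> E"
  shows "op_compl (join A B) = meet (op_compl A) (op_compl B)"
  using compl_meet[OF compl_E[OF A] compl_E[OF B]] by (metis compl_compl)

text \<open>The fixed point of the complement. Its spectral family jumps from 0 to I at 1/2, so
  being above \<open>half\<close> means having zero subspaces below level 1/2, and being below it
  means having the whole space from 1/2 on.\<close>

definition half :: "'a \<Rightarrow> 'a" where "half x = (1/2) *\<^sub>R x"

lemma half_E: "half \<in> E" and L_half: "L half t = (if t < 1/2 then {0} else UNIV)"
  using scalar_effect[of "1/2"] by (simp_all add: half_def[abs_def])

lemma compl_half: "op_compl half = half"
proof
  fix x :: 'a
  have "x = (1/2) *\<^sub>R x + (1/2) *\<^sub>R x" by (simp flip: scaleR_left_distrib)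
  then show "op_compl half x = half x" unfolding op_compl_def half_def by (metis add_diff_cancel)
qed

text \<open>For t < 1/2 the level t is below 1 - t, so the subspaces of \<open>A\<close> and of its
  complement at level t are orthogonal and meet in 0.\<close>

lemma half_le_join_compl:
  assumes A: "A \<in> E"
  shows "le half (join A (op_compl A))"
proof -
  have "L A t \<inter> L (op_compl A) t \<subseteq> {0}" if "t < 1/2" for t
    using L_compl_orth[OF A, of t t] that orth_self by auto
  then show ?thesis by (simp add: le_def L_join A compl_E L_half)
qed

lemma meet_compl_le_half:
  assumes A: "A \<in> E"
  shows "le (meet A (op_compl A)) half"
proof -
  have "op_compl (join (op_compl A) A) = meet A (op_compl A)"
    by (simp add: compl_join compl_E A compl_compl)
  moreover have "le half (join (op_compl A) A)"
    using half_le_join_compl[OF compl_E[OF A]] by (simp add: compl_compl)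
  ultimately show ?thesis
    using compl_antimono[OF half_E join_E[OF compl_E[OF A] A]] by (simp add: compl_half)
qed

text \<open>Below the level where the spectral subspaces of \<open>A\<close> and \<open>B\<close> cease to be orthogonal, the infimum in
  the formula for the meet is attained because orthogonal decompositions are unique.\<close>

lemma L_meet_orth:
  assumes A: "A \<in> E" and B: "B \<in> E" and orth: "\<And>m. m < c \<Longrightarrow> L B m \<subseteq> (L A m)\<^sup>\<bottom>" and "t < c"
  shows "L (meet A B) t = {u + v |u v. u \<in> L A t \<and> v \<in> L B t}"
proof
  have hull: "hull2 (L A m) (L B m) = {u + v |u v. u \<in> L A m \<and> v \<in> L B m}" if "m < c" for m
    by (intro hull2_orth csub_L A B orth that)
  show "{u + v |u v. u \<in> L A t \<and> v \<in> L B t} \<subseteq> L (meet A B) t"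
    using meet_le[OF A B] subspace_L[OF meet_E[OF A B], of t] by (auto simp: le_def intro!: subspace_add)
  show "L (meet A B) t \<subseteq> {u + v |u v. u \<in> L A t \<and> v \<in> L B t}"
  proof
    fix x assume "x \<in> L (meet A B) t"
    then have x: "x \<in> hull2 (L A m) (L B m)" if "t < m" for m
      using that by (auto simp: L_meet A B)
    obtain m0 where m0: "t < m0" "m0 < c" using dense \<open>t < c\<close> by blast
    from x[OF m0(1)] obtain u v where uv: "x = u + v" "u \<in> L A m0" "v \<in> L B m0"
      unfolding hull[OF m0(2)] by blast
    have *: "u \<in> L A m \<and> v \<in> L B m" if "t < m" for m
    proof -
      \<comment> \<open>The minimum keeps the level inside the orthogonal range. The decomposition
        at \<open>k\<close> is also one at \<open>m0\<close>, hence equals the fixed one by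
        uniqueness, and monotonicity carries it up to \<open>m\<close>.\<close>
      define k where "k = min m m0"
      have k: "t < k" "k < c" "k \<le> m" "k \<le> m0" using m0 that by (auto simp: k_def)
      from x[OF k(1)] obtain u' v' where uv': "x = u' + v'" "u' \<in> L A k" "v' \<in> L B k"
        unfolding hull[OF k(2)] by blast
      have in0: "u' \<in> L A m0" "v' \<in> L B m0" using uv' L_mono[OF A k(4)] L_mono[OF B k(4)] by auto
      have "u - u' = v' - v" using uv uv' by (simp add: algebra_simps)
      moreover have "u - u' \<in> L A m0" "v' - v \<in> L B m0"
        using uv in0 by (auto intro: subspace_diff subspace_L A B)
      ultimately have "u - u' = 0" using orth[OF m0(2)] orth_self[of "u - u'" "L A m0"] by auto
      then have "u = u'" "v = v'" using \<open>u - u' = v' - v\<close> by auto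
      then show ?thesis using uv' L_mono[OF A k(3)] L_mono[OF B k(3)] by auto
    qed
    have "u \<in> L A t" "v \<in> L B t" by (rule L_right[OF A], use * in blast) (rule L_right[OF B], use * in blast)
    then show "x \<in> {u + v |u v. u \<in> L A t \<and> v \<in> L B t}" using uv(1) by blast
  qed
qed

text \<open>The order puts \<open>L B m\<close> inside \<open>L A m\<close>, which is orthogonal to
  the subspace of the complement of \<open>A\<close> at the same level.\<close>

lemma L_meet_compl:
  assumes A: "A \<in> E" and B: "B \<in> E" and "le A B" and "t < 1/2"
  shows "L (meet (op_compl A) B) t = {u + v |u v. u \<in> L (op_compl A) t \<and> v \<in> L B t}"
proof (rule L_meet_orth[OF compl_E[OF A] B _ \<open>t < 1/2\<close>])
  fix m :: real assume "m < 1/2"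
  then have "L (op_compl A) m \<subseteq> (L A m)\<^sup>\<bottom>" by (intro L_compl_orth A) simp
  then show "L B m \<subseteq> (L (op_compl A) m)\<^sup>\<bottom>"
    using \<open>le A B\<close> unfolding le_def by (meson order_trans subset_orth_sym)
qed

lemma L_meet_self_compl:
  assumes A: "A \<in> E" and "t < 1/2"
  shows "L (meet A (op_compl A)) t = {u + v |u v. u \<in> L A t \<and> v \<in> L (op_compl A) t}"
  by (rule L_meet_orth[OF A compl_E[OF A] _ \<open>t < 1/2\<close>]) (rule L_compl_orth[OF A], simp)

lemma sp2:
  assumes A: "A \<in> E" and B: "B \<in> E" and "le A B"
  shows "join (meet A (op_compl A)) (meet B (op_compl B)) =
    meet (meet (op_compl A) B) (op_compl (meet (op_compl A) B))"
proof (rule L_inj)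
  define D where "D = meet (op_compl A) B"
  have D: "D \<in> E" unfolding D_def by (intro meet_E compl_E A B)
  have D': "op_compl D = join A (op_compl B)"
    unfolding D_def by (simp add: compl_meet compl_E A B compl_compl)
  show "join (meet A (op_compl A)) (meet B (op_compl B)) \<in> E" by (intro join_E meet_E compl_E A B)
  show "meet (meet (op_compl A) B) (op_compl (meet (op_compl A) B)) \<in> E" by (intro join_E meet_E compl_E A B)
  show "L (join (meet A (op_compl A)) (meet B (op_compl B))) =
    L (meet (meet (op_compl A) B) (op_compl (meet (op_compl A) B)))"
    unfolding D_def[symmetric]
  proof
    fix t
    show "L (join (meet A (op_compl A)) (meet B (op_compl B))) t = L (meet D (op_compl D)) t"
    proof (cases "t < 1/2")
      case False
      \<comment> \<open>The three elements involved all have the form C \<and> C' and lie below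
        I/2.\<close>
      have top: "L C t = UNIV" if "le C half" for C
        using that False by (auto simp: le_def L_half dest!: spec[of _ t])
      show ?thesis
        using top[OF meet_compl_le_half[OF A]] top[OF meet_compl_le_half[OF B]] top[OF meet_compl_le_half[OF D]]
        by (simp add: L_join meet_E compl_E A B)
    next
      case True
      define P1 where "P1 = L A t"
      define P2 where "P2 = L (op_compl A) t"
      define Q1 where "Q1 = L B t"
      define Q2 where "Q2 = L (op_compl B) t"
      have sub: "subspace P1" "subspace P2" "subspace Q1" "subspace Q2"
        unfolding P1_def P2_def Q1_def Q2_def by (intro subspace_L compl_E A B)+
      \<comment> \<open>These inclusions give (P1 + P2) \<inter> (Q1 + Q2) = (P2 + Q1) + (P1
        \<inter> Q2): two decompositions p1 + p2 = q1 + q2 differ by p1 - q1 = q2 - p2, a vector of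
        P1 \<inter> Q2.\<close>
      have QP: "Q1 \<subseteq> P1" "P2 \<subseteq> Q2"
        using \<open>le A B\<close> compl_antimono[OF A B \<open>le A B\<close>] by (simp_all add: le_def P1_def P2_def Q1_def Q2_def)
      have lhs: "L (join (meet A (op_compl A)) (meet B (op_compl B))) t =
          {u + v |u v. u \<in> P1 \<and> v \<in> P2} \<inter> {u + v |u v. u \<in> Q1 \<and> v \<in> Q2}"
        unfolding L_join[OF meet_E[OF A compl_E[OF A]] meet_E[OF B compl_E[OF B]]]
          L_meet_self_compl[OF A True] L_meet_self_compl[OF B True] P1_def P2_def Q1_def Q2_def ..
      have LD: "L D t = {u + v |u v. u \<in> P2 \<and> v \<in> Q1}"
        unfolding D_def P2_def Q1_def by (rule L_meet_compl[OF A B \<open>le A B\<close> True])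
      have LD': "L (op_compl D) t = P1 \<inter> Q2"
        unfolding D' P1_def Q2_def by (rule L_join[OF A compl_E[OF B]])
      have rhs: "L (meet D (op_compl D)) t = {u + v |u v. u \<in> L D t \<and> v \<in> P1 \<inter> Q2}"
        unfolding L_meet_self_compl[OF D True] LD' ..
      show ?thesis
        unfolding lhs rhs LD
      proof (intro subset_antisym subsetI)
        fix x assume "x \<in> {u + v |u v. u \<in> P1 \<and> v \<in> P2} \<inter> {u + v |u v. u \<in> Q1 \<and> v \<in> Q2}"
        then obtain p1 p2 q1 q2 where x: "x = p1 + p2" "x = q1 + q2"
          and in_: "p1 \<in> P1" "p2 \<in> P2" "q1 \<in> Q1" "q2 \<in> Q2" by blast
        have "p1 - q1 = q2 - p2" using x by (simp add: algebra_simps)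
        moreover have "p1 - q1 \<in> P1" "q2 - p2 \<in> Q2" using in_ QP by (auto intro: subspace_diff sub)
        ultimately have "p1 - q1 \<in> P1 \<inter> Q2" by simp
        moreover have "x = (p2 + q1) + (p1 - q1)" using x(1) by simp
        ultimately show "x \<in> {u + v |u v. u \<in> {u + v |u v. u \<in> P2 \<and> v \<in> Q1} \<and> v \<in> P1 \<inter> Q2}"
          using in_ by blast
      next
        fix x assume "x \<in> {u + v |u v. u \<in> {u + v |u v. u \<in> P2 \<and> v \<in> Q1} \<and> v \<in> P1 \<inter> Q2}"
        then obtain p2 q1 w where x: "x = (p2 + q1) + w" and in_: "p2 \<in> P2" "q1 \<in> Q1" "w \<in> P1" "w \<in> Q2"
          by blast
        have "x = (q1 + w) + p2" "x = q1 + (p2 + w)" using x by (simp_all add: algebra_simps)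
        moreover have "q1 + w \<in> P1" "p2 + w \<in> Q2" using in_ QP by (auto intro: subspace_add sub)
        ultimately show "x \<in> {u + v |u v. u \<in> P1 \<and> v \<in> P2} \<inter> {u + v |u v. u \<in> Q1 \<and> v \<in> Q2}"
          using in_ by blast
      qed
    qed
  qed
qed

text \<open>The equation in (SP1) is replaced by its consequence A' \<and> B \<le> I/2. Dually I/2
  \<le> A \<or> B', so L A t and L B' t meet in 0. The left side collapses to L B t because A \<or>
  A' contributes 0 below 1/2; the right side is L A t \<inter> (L B t + L B' t), which is L B t by
  modularity.\<close>

lemma sp1_lower:
  assumes A: "A \<in> E" and B: "B \<in> E" and "le A B" and D: "le (meet (op_compl A) B) half" and t: "t < 1/2"
  shows "L (meet B (join A (op_compl A))) t = L (join A (meet B (op_compl B))) t"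
proof -
  have zero: "L C t = {0}" if "C \<in> E" "le half C" "t < 1/2" for C t
    using that subspace_0[OF subspace_L[OF that(1)]] by (fastforce simp: le_def L_half dest!: spec[of _ t])
  have J1: "join A (op_compl A) \<in> E" by (intro join_E compl_E A)
  have "L (meet B (join A (op_compl A))) t = {u + v |u v. u \<in> L B t \<and> v \<in> L (join A (op_compl A)) t}"
    by (rule L_meet_orth[OF B J1 _ t]) (simp add: zero[OF J1 half_le_join_compl[OF A]] orth_iff)
  then have lhs: "L (meet B (join A (op_compl A))) t = L B t"
    by (simp add: zero[OF J1 half_le_join_compl[OF A] t])
  have "le half (join A (op_compl B))"
    using compl_antimono[OF meet_E[OF compl_E[OF A] B] half_E D]
    by (simp add: compl_half compl_meet compl_E A B compl_compl)
  then have PQ: "L A t \<inter> L (op_compl B) t = {0}"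
    using zero[OF join_E[OF A compl_E[OF B]] _ t] by (simp add: L_join A B compl_E)
  have QP: "L B t \<subseteq> L A t" using \<open>le A B\<close> by (simp add: le_def)
  have "L A t \<inter> {u + v |u v. u \<in> L B t \<and> v \<in> L (op_compl B) t} = L B t"
  proof (intro subset_antisym subsetI)
    fix x assume x: "x \<in> L A t \<inter> {u + v |u v. u \<in> L B t \<and> v \<in> L (op_compl B) t}"
    then obtain u v where uv: "x = u + v" "u \<in> L B t" "v \<in> L (op_compl B) t" by blast
    have "x \<in> L A t" "u \<in> L A t" using x uv(2) QP by blast+
    then have "x - u \<in> L A t" by (rule subspace_diff[OF subspace_L[OF A]])
    then have "v \<in> L A t \<inter> L (op_compl B) t" using uv by simp
    then show "x \<in> L B t" using PQ uv by simp
  next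
    fix x assume x: "x \<in> L B t"
    have "x = x + 0" "0 \<in> L (op_compl B) t" using subspace_0[OF subspace_L[OF compl_E[OF B]]] by auto
    then show "x \<in> L A t \<inter> {u + v |u v. u \<in> L B t \<and> v \<in> L (op_compl B) t}" using x QP by blast
  qed
  then have rhs: "L (join A (meet B (op_compl B))) t = L B t"
    unfolding L_join[OF A meet_E[OF B compl_E[OF B]]] L_meet_self_compl[OF B t] .
  show ?thesis by (simp add: lhs rhs)
qed

lemma sp1:
  assumes A: "A \<in> E" and B: "B \<in> E" and AB: "le A B"
    and D: "meet (op_compl A) B = join (meet A (op_compl A)) (meet B (op_compl B))"
  shows "meet B (join A (op_compl A)) = join A (meet B (op_compl B))"
proof (rule L_inj)
  define U where "U = meet B (join A (op_compl A))"
  define V where "V = join A (meet B (op_compl B))"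
  note E = A B compl_E[OF A] compl_E[OF B]
  show UE: "meet B (join A (op_compl A)) \<in> E" and VE: "join A (meet B (op_compl B)) \<in> E"
    by (intro meet_E join_E E)+
  have half: "le (meet (op_compl A) B) half"
    unfolding D by (intro join_le meet_compl_le_half meet_E E)
  have low: "L U t = L V t" if "t < 1/2" for t
    unfolding U_def V_def by (rule sp1_lower[OF A B AB half that])
  have comm: "meet C C' = meet C' C" "join C C' = join C' C" if "C \<in> E" "C' \<in> E" for C C'
    using that by (auto intro!: le_antisym le_meet meet_le meet_E join_le le_join join_E)
  \<comment> \<open>Complementing swaps the two sides: each becomes the other side of (SP1) for the
    pair B' \<le> A', and the half bound is the same up to commuting the meet.\<close>
  have upp: "L (op_compl U) t = L (op_compl V) t" if "t < 1/2" for t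
  proof -
    have half': "le (meet (op_compl (op_compl B)) (op_compl A)) half"
      using half comm(1)[OF B E(3)] by (simp add: compl_compl)
    have "L (meet (op_compl A) (join (op_compl B) (op_compl (op_compl B)))) t
        = L (join (op_compl B) (meet (op_compl A) (op_compl (op_compl A)))) t"
      by (rule sp1_lower[OF E(4) E(3) compl_antimono[OF A B AB] half' that])
    moreover have "op_compl U = join (op_compl B) (meet (op_compl A) (op_compl (op_compl A)))"
      by (simp add: U_def compl_meet compl_join join_E E)
    moreover have "op_compl V = meet (op_compl A) (join (op_compl B) (op_compl (op_compl B)))"
      by (simp add: V_def compl_meet compl_join meet_E E)
    ultimately show ?thesis by simp
  qed
  \<comment> \<open>For t \<ge> 1/2 every s < 1 - t lies below 1/2, so the subspaces at level t are
    determined by complements already known to agree.\<close>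
  have "L U t = L V t" if "\<not> t < 1/2" for t
  proof -
    have "L C t = (\<Inter>s\<in>{..<1 - t}. (L (op_compl C) s)\<^sup>\<bottom>)" if "C \<in> E" for C
      using L_compl[OF compl_E[OF that]] by (simp add: compl_compl)
    then show ?thesis
      using UE VE upp that by (simp add: U_def[symmetric] V_def[symmetric])
  qed
  with low show "L (meet B (join A (op_compl A))) = L (join A (meet B (op_compl B)))"
    unfolding U_def[symmetric] V_def[symmetric] by blast
qed

section \<open>Bounds of the lattice and of families of effects\<close>

lemma zero_E: "(\<lambda>x. 0) \<in> E" and zero_le: "A \<in> E \<Longrightarrow> le (\<lambda>x. 0) A"
  using scalar_effect[of 0] L_neg by (simp_all add: le_def)

lemma id_E: "id \<in> E" and le_id: "A \<in> E \<Longrightarrow> le A id"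
proof -
  have "(\<lambda>x. 1 *\<^sub>R x) = (id :: 'a \<Rightarrow> 'a)" by auto
  then have *: "id \<in> E" "L id = (\<lambda>t. if t < 1 then {0} else UNIV)" using scalar_effect[of 1] by simp_all
  then show "id \<in> E" by simp
  show "le A id" if "A \<in> E"
    using L_ge_1[OF that] subspace_0[OF subspace_L[OF that]] by (auto simp: le_def *)
qed

lemma lattice: "bounded_lattice_alg E meet join (\<lambda>x. 0) id"
  by (rule bounded_lattice_algI(1)[of E le])
    (assumption
      | rule le_refl le_antisym meet_E meet_le le_meet join_E le_join join_le zero_E zero_le id_E le_id
      | erule (1) le_trans)+

lemma lat_le_iff: "A \<in> E \<Longrightarrow> B \<in> E \<Longrightarrow> lat_le meet A B \<longleftrightarrow> le A B"
  by (rule bounded_lattice_algI(2)[of E le meet join "\<lambda>x. 0" id])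
    (assumption
      | rule le_refl le_antisym meet_E meet_le le_meet join_E le_join join_le zero_E zero_le id_E le_id
      | erule (1) le_trans)+

lemma ex_sup:
  assumes "S \<subseteq> E"
  shows "\<exists>s\<in>E. (\<forall>A\<in>S. le A s) \<and> (\<forall>B\<in>E. (\<forall>A\<in>S. le A B) \<longrightarrow> le s B)"
proof -
  \<comment> \<open>The zero effect is adjoined so that the empty family yields its resolution; the
    bare empty intersection would be the whole space even at negative levels.\<close>
  let ?F = "\<lambda>t. (if t < 0 then {0} else UNIV) \<inter> (\<Inter>A\<in>S. L A t)"
  have z: "L (\<lambda>x. 0) = (\<lambda>t. if t < 0 then {0} else UNIV)" using scalar_effect[of 0] by simp
  have F: "?F t = (\<Inter>A\<in>insert (\<lambda>x. 0) S. L A t)" for t by (simp add: z)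
  have SE: "A \<in> E" if "A \<in> insert (\<lambda>x. 0) S" for A using that assms zero_E by auto
  have "eres ?F"
    unfolding F
  proof (rule eresI)
    show "csub J (\<Inter>A\<in>insert (\<lambda>x. 0) S. L A t)" for t
      by (rule csub_Inter) (use SE csub_L in blast)
    show "(\<Inter>A\<in>insert (\<lambda>x. 0) S. L A s) \<subseteq> (\<Inter>A\<in>insert (\<lambda>x. 0) S. L A t)" if "s \<le> t" for s t
      by (intro INF_superset_mono[OF subset_refl] L_mono[OF SE that])
    show "x \<in> (\<Inter>A\<in>insert (\<lambda>x. 0) S. L A t)"
      if x: "\<And>s. t < s \<Longrightarrow> x \<in> (\<Inter>A\<in>insert (\<lambda>x. 0) S. L A s)" for t x
    proof
      fix A assume A: "A \<in> insert (\<lambda>x. 0) S"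
      have "x \<in> L A s" if "t < s" for s using x[OF that] A by blast
      then show "x \<in> L A t" by (rule L_right[OF SE[OF A]])
    qed
    show "(\<Inter>A\<in>insert (\<lambda>x. 0) S. L A t) \<subseteq> {0}" if "t < 0" for t
      using that by (auto simp: z)
    show "(\<Inter>A\<in>insert (\<lambda>x. 0) S. L A t) = UNIV" if "t \<ge> 1" for t
      using L_ge_1[OF SE that] by simp
  qed
  then obtain s where s: "s \<in> E" "L s = ?F" using eres_effect by blast
  have "le A s" if "A \<in> S" for A using that by (auto simp: le_def s)
  moreover have "le s B" if "B \<in> E" "\<forall>A\<in>S. le A B" for B
    unfolding le_def s
  proof (intro allI Int_greatest INT_greatest)
    show "L B t \<subseteq> (if t < 0 then {0} else UNIV)" for t using L_neg[OF that(1), of t] by simp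
    show "L B t \<subseteq> L A t" if "A \<in> S" for t A using that \<open>\<forall>A\<in>S. le A B\<close> by (simp add: le_def)
  qed
  ultimately show ?thesis using s(1) by blast
qed

text \<open>The antitone involution turns suprema into infima, which avoids hulls of infinitely many
  subspaces.\<close>

lemma ex_inf:
  assumes S: "S \<subseteq> E"
  shows "\<exists>s\<in>E. (\<forall>A\<in>S. le s A) \<and> (\<forall>B\<in>E. (\<forall>A\<in>S. le B A) \<longrightarrow> le B s)"
proof -
  have "op_compl ` S \<subseteq> E" using S compl_E by auto
  from ex_sup[OF this] obtain s where s: "s \<in> E" "\<And>A. A \<in> S \<Longrightarrow> le (op_compl A) s"
    "\<And>B. B \<in> E \<Longrightarrow> (\<And>A. A \<in> S \<Longrightarrow> le (op_compl A) B) \<Longrightarrow> le s B" by auto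
  have "le (op_compl s) A" if "A \<in> S" for A
    using compl_antimono[OF compl_E s(1) s(2)[OF that]] that S by (auto simp: compl_compl)
  moreover have "le B (op_compl s)" if B: "B \<in> E" "\<forall>A\<in>S. le B A" for B
  proof -
    have "le s (op_compl B)" using S B by (intro s(3) compl_E compl_antimono) auto
    from compl_antimono[OF s(1) compl_E[OF B(1)] this] show ?thesis by (simp add: compl_compl)
  qed
  ultimately show ?thesis using compl_E[OF s(1)] by blast
qed

theorem effects_super_paraorthomodular:
  "super_paraorthomodular E meet join op_compl (\<lambda>x. 0) id"
  unfolding super_paraorthomodular_def pseudo_kleene_lattice_def
proof (intro conjI ballI impI)
  show "bounded_lattice_alg E meet join (\<lambda>x. 0) id" by (rule lattice)
  show "op_compl A \<in> E" "op_compl (op_compl A) = A" if "A \<in> E" for A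
    using that by (simp_all add: compl_E compl_compl)
  show "lat_le meet (op_compl B) (op_compl A)" if A: "A \<in> E" and B: "B \<in> E" and "lat_le meet A B" for A B
    using that(3) compl_antimono[OF A B] by (simp add: lat_le_iff A B compl_E)
  show "lat_le meet (meet A (op_compl A)) (join B (op_compl B))" if A: "A \<in> E" and B: "B \<in> E" for A B
    using le_trans[OF meet_compl_le_half[OF A] half_le_join_compl[OF B]]
    by (simp add: lat_le_iff A B compl_E meet_E join_E)
  show "meet B (join A (op_compl A)) = join A (meet B (op_compl B))"
    if A: "A \<in> E" and B: "B \<in> E"
      and "lat_le meet A B \<and> meet (op_compl A) B = join (meet A (op_compl A)) (meet B (op_compl B))" for A B
    using that(3) sp1[OF A B] by (simp add: lat_le_iff A B)
  show "join (meet A (op_compl A)) (meet B (op_compl B)) = meet (meet (op_compl A) B) (op_compl (meet (op_compl A) B))"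
    if A: "A \<in> E" and B: "B \<in> E" and "lat_le meet A B" for A B
    using that(3) sp2[OF A B] by (simp add: lat_le_iff A B)
qed

theorem effects_boundedly_complete: "boundedly_complete E meet"
  unfolding boundedly_complete_def
proof (intro conjI allI impI)
  fix S assume S: "S \<subseteq> E"
  have iff: "lat_le meet A B \<longleftrightarrow> le A B" if "A \<in> S \<or> A \<in> E" "B \<in> S \<or> B \<in> E" for A B
    using that S by (intro lat_le_iff) auto
  show "\<exists>s\<in>E. (\<forall>x\<in>S. lat_le meet x s) \<and> (\<forall>b\<in>E. (\<forall>x\<in>S. lat_le meet x b) \<longrightarrow> lat_le meet s b)"
    using ex_sup[OF S] by (simp add: iff)
  show "\<exists>s\<in>E. (\<forall>x\<in>S. lat_le meet s x) \<and> (\<forall>b\<in>E. (\<forall>x\<in>S. lat_le meet b x) \<longrightarrow> lat_le meet b s)"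
    using ex_inf[OF S] by (simp add: iff)
qed

end

theorem theorem3p7:
  fixes J :: "'a::{real_inner, complete_space, second_countable_topology} \<Rightarrow> 'a"
  assumes "complex_structure J"
  shows "super_paraorthomodular (effects J) (meet_s J) (join_s J) op_compl (\<lambda>x. 0) id
         \<and> boundedly_complete (effects J) (meet_s J)"
proof -
  interpret complex_hilbert J by unfold_locales (rule assms)
  show ?thesis using effects_super_paraorthomodular effects_boundedly_complete by blast
qed

end
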